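(* Let $F$ be a Banach lattice. The following are equivalent: (i) $F^*$ is order continuous; (ii) the aw- and aaw-topologies coincide on $F$; (iii) the aw-topology is boundedly exhaustive; (iv) every bounded operator $T:F\to H$ (any Banach space $H$) which complements the aw-topology is $\infty$-DNS; (iv$'$) every bounded operator $T:F\to H$ which complements the aw-topology is DNS; (v) every closed subspace of $F$ on which the aw-topology agrees with the norm topology is $\infty$-dispersed; (v$'$) every closed subspace of $F$ on which the aw-topology agrees with the norm topology is dispersed; (vi) for no disjoint sequence of nonzero vectors does the aw-topology agree with the norm topology on its closed span.
   Context: $\mathrm{S}_F$ is the unit sphere; disjoint means $|f|\wedge|g|=0$. The absolute weak (aw-) topology: $f_p\to0$ iff $|f_p|\to0$ weakly, i.e. $\nu(|f_p|)\to0$ for all $\nu\in F^*$. $F^*_a$ is the order continuous part of $F^*$ (largest ideal on which the norm is order continuous); the aaw-topology: $f_p\to0$ iff $|f_p|\to0$ in $\sigma(F,F^*_a)$. A linear topology $\tau$ weaker than the norm topology is boundedly exhaustive if every norm-bounded disjoint sequence is $\tau$-null. $T$ complements $\tau$ if no net $(f_p)\subset\mathrm{S}_F$ is $\tau$-null with $\|Tf_p\|\to0$. $T$ is DNS if no disjoint $(f_n)\subset\mathrm{S}_F$ has $\|Tf_n\|\to0$ (equivalently its restriction to the closed span of any disjoint sequence is not strictly singular); $T$ is $\infty$-DNS if there is $r>0$ with $\liminf_n\|Tf_n\|>r$ for every disjoint $(f_n)\subset\mathrm{S}_F$. A closed subspace $E$ is dispersed if there is no $(e_n)\subset\mathrm{S}_E$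 and disjoint $(f_n)\subset F$ with $\|e_n-f_n\|\to0$ (equivalently $\liminf_n d(f_n,E)>0$ for every disjoint $(f_n)\subset\mathrm{S}_F$); $E$ is $\infty$-dispersed if there is $r>0$ with $\liminf_n d(f_n,E)>r$ for every disjoint $(f_n)\subset\mathrm{S}_F$. *)

theory Defs
  imports "HOL-Analysis.Analysis" "HOL-Probability.Discrete_Topology"
begin

class banach_lattice = banach + ordered_real_vector + lattice +
  assumes norm_lattice_mono:
    "sup x (- x) \<le> sup y (- y) \<Longrightarrow> norm x \<le> norm y"

definition labs :: "'a::banach_lattice \<Rightarrow> 'a" where
  "labs x = sup x (- x)"

definition disjoint_seq :: "(nat \<Rightarrow> 'a::banach_lattice) \<Rightarrow> bool" where
  "disjoint_seq x \<longleftrightarrow> (\<forall>m n. m \<noteq> n \<longrightarrow> inf (labs (x m)) (labs (x n)) = 0)"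

definition dle :: "('a::banach_lattice \<Rightarrow>\<^sub>L real) \<Rightarrow> ('a \<Rightarrow>\<^sub>L real) \<Rightarrow> bool" where
  "dle \<nu> \<mu> \<longleftrightarrow> (\<forall>f. 0 \<le> f \<longrightarrow> blinfun_apply \<nu> f \<le> blinfun_apply \<mu> f)"

text \<open>Value of the modulus \<open>|\<nu>|\<close> at a positive vector (Riesz--Kantorovich formula).\<close>
definition dabs_at :: "('a::banach_lattice \<Rightarrow>\<^sub>L real) \<Rightarrow> 'a \<Rightarrow> real" where
  "dabs_at \<nu> f = Sup {blinfun_apply \<nu> g | g. labs g \<le> f}"

definition down_directed :: "('a::banach_lattice \<Rightarrow>\<^sub>L real) set \<Rightarrow> bool" where
  "down_directed D \<longleftrightarrow> D \<noteq> {} \<and> (\<forall>\<mu>\<in>D. \<forall>\<nu>\<in>D. \<exists>\<kappa>\<in>D. dle \<kappa> \<mu> \<and> dle \<kappa> \<nu>)"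

definition dinf_zero :: "('a::banach_lattice \<Rightarrow>\<^sub>L real) set \<Rightarrow> bool" where
  "dinf_zero D \<longleftrightarrow> (\<forall>\<mu>\<in>D. dle 0 \<mu>) \<and> (\<forall>\<kappa>. (\<forall>\<mu>\<in>D. dle \<kappa> \<mu>) \<longrightarrow> dle \<kappa> 0)"

text \<open>The net indexed by a downward directed set \<open>D\<close> (the set itself, ordered by \<open>dle\<close>).\<close>
definition down_net :: "('a::banach_lattice \<Rightarrow>\<^sub>L real) set \<Rightarrow> ('a \<Rightarrow>\<^sub>L real) filter" where
  "down_net D = (INF \<mu>\<in>D. principal {\<nu>\<in>D. dle \<nu> \<mu>})"

definition dual_order_continuous :: "'a::banach_lattice itself \<Rightarrow> bool" where
  "dual_order_continuous _ \<longleftrightarrow>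
     (\<forall>D::('a \<Rightarrow>\<^sub>L real) set. down_directed D \<and> dinf_zero D \<longrightarrow>
        ((\<lambda>\<mu>. norm \<mu>) \<longlongrightarrow> 0) (down_net D))"

definition dual_oc_part :: "('a::banach_lattice \<Rightarrow>\<^sub>L real) set" where
  "dual_oc_part = {\<nu>. \<forall>D. down_directed D \<and> dinf_zero D \<and>
        (\<forall>\<mu>\<in>D. \<forall>f. 0 \<le> f \<longrightarrow> blinfun_apply \<mu> f \<le> dabs_at \<nu> f) \<longrightarrow>
        ((\<lambda>\<mu>. norm \<mu>) \<longlongrightarrow> 0) (down_net D)}"

section \<open>The aw- and aaw-topologies (via null nets, represented by filters)\<close>

definition aw_null :: "'a::banach_lattice filter \<Rightarrow> bool" where
  "aw_null G \<longleftrightarrow> (\<forall>\<nu>::'a \<Rightarrow>\<^sub>L real. ((\<lambda>f. blinfun_apply \<nu> (labs f)) \<longlongrightarrow> 0) G)"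

definition aaw_null :: "'a::banach_lattice filter \<Rightarrow> bool" where
  "aaw_null G \<longleftrightarrow> (\<forall>\<nu>\<in>dual_oc_part. ((\<lambda>f. blinfun_apply \<nu> (labs f)) \<longlongrightarrow> 0) G)"

definition aw_eq_aaw :: "'a::banach_lattice itself \<Rightarrow> bool" where
  "aw_eq_aaw _ \<longleftrightarrow> (\<forall>G::'a filter. aw_null G \<longleftrightarrow> aaw_null G)"

definition aw_boundedly_exhaustive :: "'a::banach_lattice itself \<Rightarrow> bool" where
  "aw_boundedly_exhaustive _ \<longleftrightarrow>
     (\<forall>x::nat \<Rightarrow> 'a. bounded (range x) \<and> disjoint_seq x \<longrightarrow> aw_null (filtermap x sequentially))"

definition aw_agrees_norm_on :: "'a::banach_lattice set \<Rightarrow> bool" where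
  "aw_agrees_norm_on E \<longleftrightarrow>
     (\<forall>G::'a filter. G \<le> principal E \<longrightarrow> (aw_null G \<longleftrightarrow> (id \<longlongrightarrow> 0) G))"

definition complements_aw :: "('a::banach_lattice \<Rightarrow>\<^sub>L 'b::banach) \<Rightarrow> bool" where
  "complements_aw T \<longleftrightarrow> \<not> (\<exists>G::'a filter. G \<noteq> bot \<and> eventually (\<lambda>f. norm f = 1) G \<and>
       aw_null G \<and> ((\<lambda>f. norm (blinfun_apply T f)) \<longlongrightarrow> 0) G)"

definition DNS :: "('a::banach_lattice \<Rightarrow>\<^sub>L 'b::banach) \<Rightarrow> bool" where
  "DNS T \<longleftrightarrow> \<not> (\<exists>x. disjoint_seq x \<and> (\<forall>n. norm (x n) = 1) \<and>
       (\<lambda>n. norm (blinfun_apply T (x n))) \<longlonglongrightarrow> 0)"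

definition inf_DNS :: "('a::banach_lattice \<Rightarrow>\<^sub>L 'b::banach) \<Rightarrow> bool" where
  "inf_DNS T \<longleftrightarrow> (\<exists>r>0. \<forall>x. disjoint_seq x \<and> (\<forall>n. norm (x n) = 1) \<longrightarrow>
       liminf (\<lambda>n. ereal (norm (blinfun_apply T (x n)))) > ereal r)"

definition dispersed :: "'a::banach_lattice set \<Rightarrow> bool" where
  "dispersed E \<longleftrightarrow> \<not> (\<exists>e f. (\<forall>n. e n \<in> E \<and> norm (e n) = 1) \<and> disjoint_seq f \<and>
       (\<lambda>n. norm (e n - f n)) \<longlonglongrightarrow> 0)"

definition inf_dispersed :: "'a::banach_lattice set \<Rightarrow> bool" where
  "inf_dispersed E \<longleftrightarrow> (\<exists>r>0. \<forall>f. disjoint_seq f \<and> (\<forall>n. norm (f n) = 1) \<longrightarrow>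
       liminf (\<lambda>n. ereal (infdist (f n) E)) > ereal r)"

definition closed_subspace :: "'a::banach_lattice set \<Rightarrow> bool" where
  "closed_subspace E \<longleftrightarrow> subspace E \<and> closed E"

text \<open>\<open>\<ell>\<^sub>\<infinity>(F)\<close>: bounded real functions on the underlying set of \<open>F\<close>
  (continuous w.r.t. the discrete topology).  Every Banach space \<open>H\<close>
  receiving a bounded operator from \<open>F\<close> may be replaced by the closed range,
  which embeds isometrically into this space.\<close>
instance bcontfun :: (metric_space, banach) banach ..

type_synonym 'a linf = "'a discrete \<Rightarrow>\<^sub>C real"

end

(* Idea.  If F* is not order continuous, some positive functional nu is not uniformly small on the
   part of the unit ball outside an order interval, and a disjointification gives a bounded disjoint
   sequence on which nu stays away from 0.  Its closed span is a copy of l_1 on which nu(|f|) dominates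
   a multiple of the norm, so there the aw-topology is the norm topology, and the quotient map by this
   span complements the aw-topology without being DNS.  Conversely, if nu lies in the order continuous
   part of F*, then the components of |nu| carried by the terms of a disjoint sequence have a series
   whose tails decrease to 0, hence in norm, so bounded disjoint sequences are nu-null.  A disjoint
   sequence on the sphere is then aw-null, and an operator complementing the aw-topology is bounded
   below on S_F intersected with an aw-neighbourhood of 0. *)

theory Submission
  imports Defs "HOL-Library.Lattice_Algebras"
begin

section \<open>Banach lattices\<close>

text \<open>The lattice structure of F* is never built: a functional is prescribed by its values on
  positive vectors, where additivity, positive homogeneity and a norm bound suffice. Components of
  |\<nu>| and infima of directed sets arise in this way. Order intervals and order continuity are
  linked by the splitting y \<le> u + (y - u)^+: a directed set with infimum 0 becomes small at the
  single vector u, while one fixed member is already small on (y - u)^+ uniformly over the positive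
  unit ball. Nets are represented by filters. As the aw-topology need not be metrizable, failure of
  infinity-DNS does not yield a diagonal aw-null sequence; an iterated limit of filters takes its
  place. Norming functionals embed every quotient F/E isometrically into one space of bounded
  functions on F, so this single target space tests the conditions on operators.\<close>

instance banach_lattice \<subseteq> lattice_ab_group_add ..

lemma labs_nonneg [simp]: "0 \<le> labs x"
proof -
  have "0 \<le> labs x + labs x"
    using add_mono[of x "labs x" "- x" "labs x"] by (simp add: labs_def)
  then show ?thesis by simp
qed

lemma labs_ge: "x \<le> labs x" "- x \<le> labs x"
  by (simp_all add: labs_def)

lemma labs_leI: "x \<le> y \<Longrightarrow> - x \<le> y \<Longrightarrow> labs x \<le> y"
  by (simp add: labs_def)

lemma labs_le_iff: "labs x \<le> y \<longleftrightarrow> x \<le> y \<and> - x \<le> y"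
  by (simp add: labs_def)

lemma labs_minus [simp]: "labs (- x) = labs x"
  by (simp add: labs_def sup_commute)

lemma labs_of_nonneg: "0 \<le> x \<Longrightarrow> labs x = x"
  unfolding labs_def by (rule sup_absorb1) (meson neg_le_0_iff_le order_trans)

lemma labs_0 [simp]: "labs 0 = 0"
  by (simp add: labs_of_nonneg)

lemma labs_labs [simp]: "labs (labs x) = labs x"
  by (simp add: labs_of_nonneg)

lemma norm_mono_labs: "labs x \<le> labs y \<Longrightarrow> norm x \<le> norm y"
  unfolding labs_def by (rule norm_lattice_mono)

lemma norm_labs [simp]: "norm (labs x) = norm x"
  by (intro antisym norm_mono_labs) simp_all

lemma norm_mono_nonneg: "0 \<le> x \<Longrightarrow> x \<le> y \<Longrightarrow> norm x \<le> norm y"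
  for x y :: "'a::banach_lattice"
  by (rule norm_mono_labs) (simp add: labs_of_nonneg order_trans[of 0 x y])

lemma labs_eq_0_iff [simp]: "labs x = 0 \<longleftrightarrow> x = 0"
  by (metis norm_eq_zero norm_labs)

lemma labs_triangle: "labs (x + y) \<le> labs x + labs y"
  by (rule labs_leI) (use add_mono[OF labs_ge(1) labs_ge(1)] add_mono[OF labs_ge(2) labs_ge(2)] in auto)

lemma labs_diff_labs: "labs (labs x - labs y) \<le> labs (x - y)"
proof (rule labs_leI)
  show "labs x - labs y \<le> labs (x - y)"
    using labs_triangle[of "x - y" y] by (simp add: algebra_simps)
  show "- (labs x - labs y) \<le> labs (x - y)"
    using labs_triangle[of "y - x" x] labs_minus[of "x - y"] by (simp add: algebra_simps)
qed

lemma norm_labs_diff: "norm (labs x - labs y) \<le> norm (x - y)"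
  by (rule norm_mono_labs[OF labs_diff_labs])

lemma continuous_labs [continuous_intros]:
  "continuous_on S (labs :: 'a::banach_lattice \<Rightarrow> 'a)"
  unfolding continuous_on_iff dist_norm by (meson norm_labs_diff order_le_less_trans)

lemma scaleR_sup:
  fixes x y :: "'a::banach_lattice"
  assumes "0 < c"
  shows "c *\<^sub>R sup x y = sup (c *\<^sub>R x) (c *\<^sub>R y)"
proof (rule antisym)
  have "sup x y \<le> inverse c *\<^sub>R sup (c *\<^sub>R x) (c *\<^sub>R y)"
    using assms by (auto intro!: le_supI simp: pos_le_divideR_eq)
  then show "c *\<^sub>R sup x y \<le> sup (c *\<^sub>R x) (c *\<^sub>R y)"
    using pos_le_divideR_eq[OF assms] by blast
  show "sup (c *\<^sub>R x) (c *\<^sub>R y) \<le> c *\<^sub>R sup x y"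
    using assms by (simp add: scaleR_left_mono)
qed

lemma labs_scaleR: "labs (c *\<^sub>R x) = \<bar>c\<bar> *\<^sub>R labs x"
proof -
  have pos: "labs (d *\<^sub>R y) = d *\<^sub>R labs y" if "0 < d" for d y
    using that by (simp add: labs_def scaleR_sup)
  consider "c = 0" | "0 < c" | "c < 0" by linarith
  then show ?thesis
  proof cases
    case 3
    then show ?thesis using pos[of "- c" x] labs_minus[of "c *\<^sub>R x"] by simp
  qed (simp_all add: pos)
qed

lemma pprt_scaleR: "0 \<le> c \<Longrightarrow> pprt (c *\<^sub>R x) = c *\<^sub>R pprt (x::'a::banach_lattice)"
  by (cases "c = 0") (simp_all add: pprt_def scaleR_sup)

lemma nprt_conv_pprt: "nprt x = - pprt (- x)" for x :: "'a::lattice_ab_group_add"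
  by (simp add: pprt_neg)

lemma pprt_le_labs: "pprt x \<le> labs x"
  by (simp add: pprt_def labs_ge)

lemma norm_pprt_le: "norm (pprt x) \<le> norm (x::'a::banach_lattice)"
  using norm_mono_nonneg[OF zero_le_pprt pprt_le_labs, of x] by simp

section \<open>Disjointness and Riesz decomposition\<close>

lemma inf_pprt_pprt_minus: "inf (pprt x) (pprt (- x)) = 0" for x :: "'a::lattice_ab_group_add"
proof -
  have "inf (pprt x) (pprt (- x)) = inf (x + pprt (- x)) (0 + pprt (- x))"
    using prts[of x] by (metis add_0 diff_add_cancel diff_conv_add_uminus nprt_conv_pprt)
  also have "\<dots> = inf x 0 + pprt (- x)"
    by (rule add_inf_distrib_right[symmetric])
  also have "\<dots> = 0"
    unfolding pprt_neg nprt_def by (rule right_minus)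
  finally show ?thesis .
qed

text \<open>The left side lies below both \<open>a + inf b c\<close> and \<open>c + inf b c\<close>;
  the meet of these two is the right side.\<close>

lemma inf_add_le:
  fixes a b c :: "'a::lattice_ab_group_add"
  assumes "0 \<le> a" "0 \<le> b" "0 \<le> c"
  shows "inf (a + b) c \<le> inf a c + inf b c"
proof -
  have "inf (a + b) c \<le> a + inf b c"
    using assms by (simp add: add_inf_distrib_left le_infI2 add_increasing)
  moreover have "inf (a + b) c \<le> c + inf b c"
    using assms by (simp add: le_infI2 add_increasing2)
  ultimately show ?thesis
    by (simp add: add_inf_distrib_right)
qed

text \<open>The witnesses are \<open>inf c a\<close> and the remainder;
  \<open>c - b \<le> inf c a\<close> keeps the remainder below \<open>b\<close>.\<close>

lemma riesz_decomposition:
  fixes a b c :: "'a::lattice_ab_group_add"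
  assumes "0 \<le> a" "0 \<le> b" "0 \<le> c" "c \<le> a + b"
  shows "\<exists>u v. 0 \<le> u \<and> 0 \<le> v \<and> u \<le> a \<and> v \<le> b \<and> c = u + v"
proof -
  have "c - b \<le> inf c a"
    using assms by (auto simp: diff_le_eq)
  then have "c - inf c a \<le> b"
    by (metis add.commute diff_le_eq)
  moreover have "0 \<le> c - inf c a"
    by (metis diff_ge_0_iff_ge inf_le1)
  moreover have "c = inf c a + (c - inf c a)"
    by (metis add.commute diff_add_cancel)
  moreover have "0 \<le> inf c a" "inf c a \<le> a"
    using assms by auto
  ultimately show ?thesis by blast
qed

lemma inf_eq_0_mono:
  fixes a b a' b' :: "'a::lattice_ab_group_add"
  assumes "inf a b = 0" "0 \<le> a'" "a' \<le> a" "0 \<le> b'" "b' \<le> b"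
  shows "inf a' b' = 0"
  by (rule antisym) (use assms inf_mono[of a' a b' b] in auto)

lemma inf_add_eq_0:
  fixes a b c :: "'a::lattice_ab_group_add"
  assumes "0 \<le> a" "0 \<le> b" "0 \<le> c" "inf a c = 0" "inf b c = 0"
  shows "inf (a + b) c = 0"
  by (rule antisym) (use assms inf_add_le[of a b c] in auto)

text \<open>Integer multiples follow by adding disjoint vectors; any real factor is dominated by an
  integer.\<close>

lemma inf_scaleR_eq_0:
  fixes a b :: "'a::banach_lattice"
  assumes "0 \<le> a" "0 \<le> b" "inf a b = 0" "0 \<le> s"
  shows "inf (s *\<^sub>R a) b = 0"
proof -
  have n: "inf (real n *\<^sub>R a) b = 0" for n
  proof (induction n)
    case (Suc n)
    then show ?case
      using inf_add_eq_0[of "real n *\<^sub>R a" a b] assms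
      by (simp add: algebra_simps scaleR_nonneg_nonneg)
  qed (use assms in \<open>simp add: inf_absorb1\<close>)
  obtain n where "s \<le> real n" using real_arch_simple by blast
  then show ?thesis
    using assms by (intro inf_eq_0_mono[OF n[of n]]) (auto simp: scaleR_nonneg_nonneg scaleR_right_mono)
qed

lemma inf_sum_eq_0:
  fixes a :: "'i \<Rightarrow> 'a::lattice_ab_group_add"
  assumes "0 \<le> c" "\<And>i. i \<in> I \<Longrightarrow> 0 \<le> a i" "\<And>i. i \<in> I \<Longrightarrow> inf (a i) c = 0"
  shows "inf (sum a I) c = 0"
  using assms
proof (induction I rule: infinite_finite_induct)
  case (insert i I)
  then show ?case by (simp add: inf_add_eq_0 sum_nonneg)
qed (auto simp: inf_absorb1)

lemma labs_add_disjoint: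
  assumes "inf (labs x) (labs y) = 0"
  shows "labs (x + y) = labs x + labs y"
proof (rule antisym[OF labs_triangle])
  \<comment> \<open>Both \<open>|x|\<close> and \<open>|y|\<close> lie below \<open>|x + y|\<close> plus the other one; disjointness removes the excess.\<close>
  have sup: "labs x + labs y = sup (labs x) (labs y)"
    using add_eq_inf_sup[of "labs x" "labs y"] assms by simp
  have *: "labs u \<le> labs (u + v)" if uv: "inf (labs u) (labs v) = 0" for u v :: 'a
  proof -
    have "labs u \<le> labs (u + v) + labs v"
      using labs_triangle[of "u + v" "- v"] by simp
    then have "labs u = inf (labs (u + v) + labs v) (labs u)"
      by (simp add: inf_absorb2)
    also have "\<dots> \<le> inf (labs (u + v)) (labs u) + inf (labs v) (labs u)"
      by (rule inf_add_le) simp_all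
    also have "\<dots> \<le> labs (u + v)"
      using uv by (simp add: inf_commute)
    finally show ?thesis .
  qed
  show "labs x + labs y \<le> labs (x + y)"
    unfolding sup using *[of x y] *[of y x] assms by (simp add: inf_commute add.commute)
qed

text \<open>Induction with additivity of the modulus on disjoint vectors. This is what turns a span
  of disjoint vectors into an l_1 estimate later.\<close>

lemma labs_sum_disjoint:
  assumes "finite I" "disjoint_seq x"
  shows "labs (\<Sum>i\<in>I. c i *\<^sub>R x i) = (\<Sum>i\<in>I. \<bar>c i\<bar> *\<^sub>R labs (x i))"
  using assms(1)
proof (induction I)
  case (insert j I)
  have d: "inf (labs (x i)) (labs (x j)) = 0" if "i \<in> I" for i
    using assms(2) insert.hyps that unfolding disjoint_seq_def by metis
  have "inf (labs (\<Sum>i\<in>I. c i *\<^sub>R x i)) (labs (c j *\<^sub>R x j)) = 0"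
    unfolding insert.IH
  proof (rule inf_sum_eq_0)
    fix i assume "i \<in> I"
    show "inf (\<bar>c i\<bar> *\<^sub>R labs (x i)) (labs (c j *\<^sub>R x j)) = 0"
      using inf_scaleR_eq_0[of "labs (x j)" "labs (x i)" "\<bar>c j\<bar>"] d[OF \<open>i \<in> I\<close>]
      by (intro inf_scaleR_eq_0) (simp_all add: labs_scaleR scaleR_nonneg_nonneg inf_commute)
  qed (auto simp: scaleR_nonneg_nonneg)
  then show ?case
    using insert labs_add_disjoint[of "c j *\<^sub>R x j" "\<Sum>i\<in>I. c i *\<^sub>R x i"]
    by (simp add: labs_scaleR inf_commute)
qed simp

text \<open>The cone is the fixed-point set of the modulus, which is a contraction.\<close>

lemma closed_nonneg: "closed {x::'a::banach_lattice. 0 \<le> x}"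
proof -
  have "{x::'a. 0 \<le> x} = {x. labs x = x}"
    using labs_nonneg labs_of_nonneg by metis
  then show ?thesis
    by (simp add: closed_Collect_eq continuous_labs)
qed

lemma disjoint_seq_scaleR:
  assumes "disjoint_seq x"
  shows "disjoint_seq (\<lambda>n. c n *\<^sub>R x n)"
  unfolding disjoint_seq_def
proof (intro allI impI)
  fix m n :: nat assume "m \<noteq> n"
  then have "inf (labs (x m)) (\<bar>c n\<bar> *\<^sub>R labs (x n)) = 0"
    using assms inf_scaleR_eq_0[of "labs (x n)" "labs (x m)" "\<bar>c n\<bar>"]
    by (simp add: disjoint_seq_def inf_commute)
  then show "inf (labs (c m *\<^sub>R x m)) (labs (c n *\<^sub>R x n)) = 0"
    by (simp add: labs_scaleR inf_scaleR_eq_0 scaleR_nonneg_nonneg)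
qed

lemma disjoint_seq_comp: "disjoint_seq x \<Longrightarrow> inj r \<Longrightarrow> disjoint_seq (\<lambda>n. x (r n))"
  by (auto simp: disjoint_seq_def inj_def)

section \<open>Functionals on a Banach lattice\<close>

text \<open>Put q x = p (x^+) - p (x^-). Additivity of \<open>p\<close> makes p a - p b depend on a
  - b alone, hence q is linear; q is bounded because the positive and negative parts do not exceed x
  in norm.\<close>

lemma blinfun_extend_positive_cone:
  fixes p :: "'a::banach_lattice \<Rightarrow> real"
  assumes add: "\<And>x y. 0 \<le> x \<Longrightarrow> 0 \<le> y \<Longrightarrow> p (x + y) = p x + p y"
    and scale: "\<And>c x. 0 < c \<Longrightarrow> 0 \<le> x \<Longrightarrow> p (c *\<^sub>R x) = c * p x"
    and bound: "\<And>x. 0 \<le> x \<Longrightarrow> \<bar>p x\<bar> \<le> C * norm x"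
  shows "\<exists>\<phi> :: 'a \<Rightarrow>\<^sub>L real. \<forall>x\<ge>0. blinfun_apply \<phi> x = p x"
proof -
  define q where "q x = p (pprt x) - p (pprt (- x))" for x
  have p0: "p 0 = 0" using add[of 0 0] by simp
  have split: "x = pprt x - pprt (- x)" for x :: 'a
    using prts[of x] by (metis diff_conv_add_uminus nprt_conv_pprt)
  have q_diff: "q (a - b) = p a - p b" if "0 \<le> a" "0 \<le> b" for a b
  proof -
    \<comment> \<open>Two representations of one vector as a difference of positive ones, written
      without subtraction so that additivity of \<open>p\<close> on the cone applies.\<close>
    have "pprt (a - b) + b = a + pprt (- (a - b))"
      using split[of "a - b"] by (simp add: algebra_simps)
    then show ?thesis
      using add[of "pprt (a - b)" b] add[of a "pprt (- (a - b))"] that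
      unfolding q_def by (smt (verit) zero_le_pprt)
  qed
  have qadd: "q (x + y) = q x + q y" for x y
  proof -
    have "x + y = (pprt x + pprt y) - (pprt (- x) + pprt (- y))"
      by (subst split[of x], subst split[of y]) (simp add: algebra_simps)
    then have "q (x + y) = p (pprt x + pprt y) - p (pprt (- x) + pprt (- y))"
      using q_diff[of "pprt x + pprt y" "pprt (- x) + pprt (- y)"] by simp
    then show ?thesis by (simp add: add q_def)
  qed
  have qneg: "q (- x) = - q x" for x by (simp add: q_def)
  have qpos: "q (c *\<^sub>R x) = c * q x" if "0 < c" for c x
  proof -
    have "pprt (c *\<^sub>R x) = c *\<^sub>R pprt x" "pprt (- (c *\<^sub>R x)) = c *\<^sub>R pprt (- x)"
      using pprt_scaleR[of c x] pprt_scaleR[of c "- x"] that by auto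
    then show ?thesis
      unfolding q_def by (simp only: scale[OF that] zero_le_pprt right_diff_distrib)
  qed
  have qscale: "q (c *\<^sub>R x) = c * q x" for c x
  proof -
    consider "c = 0" | "0 < c" | "c < 0" by linarith
    then show ?thesis
    proof cases
      case 3
      then show ?thesis using qpos[of "- c" x] qneg[of "c *\<^sub>R x"] by simp
    next
      case 1
      then show ?thesis by (simp add: q_def p0)
    qed (simp add: qpos)
  qed
  have C: "\<bar>p x\<bar> \<le> \<bar>C\<bar> * norm x" if "0 \<le> x" for x
    using bound[OF that] by (meson abs_ge_self mult_right_mono norm_ge_zero order_trans)
  have "bounded_linear q"
  proof (rule bounded_linear_intro[where K = "2 * \<bar>C\<bar>"])
    fix x
    have "\<bar>p (pprt x)\<bar> \<le> \<bar>C\<bar> * norm x" "\<bar>p (pprt (- x))\<bar> \<le> \<bar>C\<bar> * norm x"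
      using order_trans[OF C[OF zero_le_pprt] mult_left_mono[OF norm_pprt_le abs_ge_zero]]
        norm_minus_cancel[of x] by metis+
    then show "norm (q x) \<le> norm x * (2 * \<bar>C\<bar>)"
      by (simp add: q_def algebra_simps)
  qed (simp_all add: qadd qscale)
  then have "\<forall>x\<ge>0. blinfun_apply (Blinfun q) x = p x"
    using q_diff[of _ 0] by (simp add: bounded_linear_Blinfun_apply p0)
  then show ?thesis by blast
qed

text \<open>These are the positive cones of ideals. The notion covers both the whole cone and the
  ideal generated by one vector, so a single supremum formula yields positive parts and
  components.\<close>

definition solid_cone :: "'a::banach_lattice set \<Rightarrow> bool" where
  "solid_cone A \<longleftrightarrow> 0 \<in> A \<and> (\<forall>a\<in>A. 0 \<le> a) \<and> (\<forall>a\<in>A. \<forall>b\<in>A. a + b \<in> A)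
     \<and> (\<forall>a\<in>A. \<forall>c\<ge>0. c *\<^sub>R a \<in> A) \<and> (\<forall>a\<in>A. \<forall>b. 0 \<le> b \<and> b \<le> a \<longrightarrow> b \<in> A)"

lemma solid_coneD:
  assumes "solid_cone A"
  shows "0 \<in> A" "a \<in> A \<Longrightarrow> 0 \<le> a" "a \<in> A \<Longrightarrow> b \<in> A \<Longrightarrow> a + b \<in> A"
    "a \<in> A \<Longrightarrow> 0 \<le> c \<Longrightarrow> c *\<^sub>R a \<in> A" "a \<in> A \<Longrightarrow> 0 \<le> b \<Longrightarrow> b \<le> a \<Longrightarrow> b \<in> A"
proof -
  note A = assms[unfolded solid_cone_def]
  show "0 \<in> A" using A by (elim conjE)
  have "\<forall>a\<in>A. 0 \<le> a" using A by (elim conjE)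
  then show "a \<in> A \<Longrightarrow> 0 \<le> a" by (rule bspec)
  have "\<forall>a\<in>A. \<forall>b\<in>A. a + b \<in> A" using A by (elim conjE)
  then show "a \<in> A \<Longrightarrow> b \<in> A \<Longrightarrow> a + b \<in> A" by (elim ballE) auto
  have "\<forall>a\<in>A. \<forall>c\<ge>0. c *\<^sub>R a \<in> A" using A by (elim conjE)
  then show "a \<in> A \<Longrightarrow> 0 \<le> c \<Longrightarrow> c *\<^sub>R a \<in> A" by (elim ballE) auto
  have "\<forall>a\<in>A. \<forall>b. 0 \<le> b \<and> b \<le> a \<longrightarrow> b \<in> A" using A by (elim conjE)
  then show "a \<in> A \<Longrightarrow> 0 \<le> b \<Longrightarrow> b \<le> a \<Longrightarrow> b \<in> A" by (metis)
qed

lemma blinfun_le_norm: "blinfun_apply \<nu> x \<le> norm \<nu> * norm x"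
  for \<nu> :: "'a::real_normed_vector \<Rightarrow>\<^sub>L real"
  using norm_blinfun[of \<nu> x] by simp

lemma blinfun_le_norm_mono:
  fixes \<nu> :: "'a::banach_lattice \<Rightarrow>\<^sub>L real"
  assumes "0 \<le> a" "a \<le> f"
  shows "blinfun_apply \<nu> a \<le> norm \<nu> * norm f"
  using blinfun_le_norm[of \<nu> a] mult_left_mono[OF norm_mono_nonneg[OF assms], of "norm \<nu>"] by simp

lemma solid_cone_bdd_above:
  fixes \<nu> :: "'a::banach_lattice \<Rightarrow>\<^sub>L real"
  assumes "solid_cone A"
  shows "bdd_above {blinfun_apply \<nu> a |a. a \<in> A \<and> a \<le> f}"
proof (rule bdd_aboveI)
  fix r assume "r \<in> {blinfun_apply \<nu> a |a. a \<in> A \<and> a \<le> f}"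
  then obtain a where a: "r = blinfun_apply \<nu> a" "0 \<le> a" "a \<le> f"
    using solid_coneD(2)[OF assms] by blast
  then show "r \<le> norm \<nu> * norm f"
    by (simp add: blinfun_le_norm_mono)
qed

text \<open>For \<open>A\<close> the positive cone this is the positive part of \<open>\<nu>\<close>; for \<open>A\<close> the positive cone of an
  ideal and \<open>\<nu> \<ge> 0\<close> it is the component of \<open>\<nu>\<close> carried by that ideal.\<close>

lemma restrict_solid_cone_exists:
  fixes \<nu> :: "'a::banach_lattice \<Rightarrow>\<^sub>L real"
  assumes A: "solid_cone A"
  shows "\<exists>\<phi> :: 'a \<Rightarrow>\<^sub>L real. \<forall>f\<ge>0. blinfun_apply \<phi> f = Sup {blinfun_apply \<nu> a |a. a \<in> A \<and> a \<le> f}"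
proof (rule blinfun_extend_positive_cone[where C = "norm \<nu>"])
  let ?S = "\<lambda>f. {blinfun_apply \<nu> a |a. a \<in> A \<and> a \<le> f}"
  note zero = solid_coneD(1)[OF A] and pos = solid_coneD(2)[OF A] and plus = solid_coneD(3)[OF A]
    and mult = solid_coneD(4)[OF A] and solid = solid_coneD(5)[OF A]
  have ne: "?S f \<noteq> {}" if "0 \<le> f" for f
    using that zero by blast
  have up: "blinfun_apply \<nu> a \<le> Sup (?S f)" if "a \<in> A" "a \<le> f" for a f
    by (rule cSup_upper[OF _ solid_cone_bdd_above[OF A]]) (use that in blast)
  fix f :: 'a assume f: "0 \<le> f"
  have "Sup (?S f) \<le> norm \<nu> * norm f"
  proof (rule cSup_least[OF ne[OF f]])
    fix r assume "r \<in> ?S f"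
    then show "r \<le> norm \<nu> * norm f"
      using pos blinfun_le_norm_mono by auto
  qed
  moreover have "0 \<le> Sup (?S f)" using up[OF zero f] by simp
  ultimately show "\<bar>Sup (?S f)\<bar> \<le> norm \<nu> * norm f" by simp
  {
    fix g :: 'a assume g: "0 \<le> g"
    show "Sup (?S (f + g)) = Sup (?S f) + Sup (?S g)"
    proof (rule antisym)
      show "Sup (?S (f + g)) \<le> Sup (?S f) + Sup (?S g)"
      proof (rule cSup_least)
        show "?S (f + g) \<noteq> {}" using f g by (intro ne) simp
        fix r assume "r \<in> ?S (f + g)"
        then obtain c where c: "r = blinfun_apply \<nu> c" "c \<in> A" "c \<le> f + g" by blast
        \<comment> \<open>Riesz decomposition splits a competitor for f + g into competitors for f
          and g; solidity keeps both pieces in \<open>A\<close>.\<close>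
        then obtain u v where uv: "0 \<le> u" "0 \<le> v" "u \<le> f" "v \<le> g" "c = u + v"
          using riesz_decomposition[OF f g pos[OF c(2)] c(3)] by blast
        then have "u \<in> A" "v \<in> A"
          using solid[OF c(2), of u] solid[OF c(2), of v] by simp_all
        then show "r \<le> Sup (?S f) + Sup (?S g)"
          using up[of u f] up[of v g] uv c by (simp add: blinfun.add_right)
      qed
      have "Sup (?S f) \<le> Sup (?S (f + g)) - blinfun_apply \<nu> b" if b: "b \<in> A" "b \<le> g" for b
      proof (rule cSup_least[OF ne[OF f]])
        fix r assume "r \<in> ?S f"
        then obtain a where "r = blinfun_apply \<nu> a" "a \<in> A" "a \<le> f" by blast
        then show "r \<le> Sup (?S (f + g)) - blinfun_apply \<nu> b"
          using up[of "a + b" "f + g"] plus[of a b] b by (simp add: blinfun.add_right add_mono)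
      qed
      then have "Sup (?S g) \<le> Sup (?S (f + g)) - Sup (?S f)"
        by (intro cSup_least[OF ne[OF g]]) force
      then show "Sup (?S f) + Sup (?S g) \<le> Sup (?S (f + g))" by simp
    qed
  }
  {
    fix c :: real assume c: "0 < c"
    have le: "Sup (?S (d *\<^sub>R h)) \<le> d * Sup (?S h)" if "0 < d" "0 \<le> h" for d h
    proof (rule cSup_least)
      show "?S (d *\<^sub>R h) \<noteq> {}" using that by (intro ne) (simp add: scaleR_nonneg_nonneg)
      fix r assume "r \<in> ?S (d *\<^sub>R h)"
      then obtain a where a: "r = blinfun_apply \<nu> a" "a \<in> A" "a \<le> d *\<^sub>R h" by blast
      then have "blinfun_apply \<nu> (a /\<^sub>R d) \<le> Sup (?S h)"
        using that by (intro up mult) (simp_all add: pos_divideR_le_eq)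
      then show "r \<le> d * Sup (?S h)"
        using that a by (simp add: blinfun.scaleR_right field_simps)
    qed
    show "Sup (?S (c *\<^sub>R f)) = c * Sup (?S f)"
    proof (rule antisym)
      have "Sup (?S (inverse c *\<^sub>R (c *\<^sub>R f))) \<le> inverse c * Sup (?S (c *\<^sub>R f))"
        by (rule le) (use c f in \<open>simp_all add: scaleR_nonneg_nonneg\<close>)
      then show "c * Sup (?S f) \<le> Sup (?S (c *\<^sub>R f))"
        using c by (simp add: field_simps)
    qed (rule le[OF c f])
  }
qed

definition restrict_cone :: "'a::banach_lattice set \<Rightarrow> ('a \<Rightarrow>\<^sub>L real) \<Rightarrow> ('a \<Rightarrow>\<^sub>L real)" where
  "restrict_cone A \<nu> = (SOME \<phi>. \<forall>f\<ge>0. blinfun_apply \<phi> f = Sup {blinfun_apply \<nu> a |a. a \<in> A \<and> a \<le> f})"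

lemma restrict_cone_apply:
  assumes "solid_cone A" "0 \<le> f"
  shows "blinfun_apply (restrict_cone A \<nu>) f = Sup {blinfun_apply \<nu> a |a. a \<in> A \<and> a \<le> f}"
  using someI_ex[OF restrict_solid_cone_exists[OF assms(1), of \<nu>]] assms(2)
  unfolding restrict_cone_def by blast

lemma restrict_cone_upper:
  assumes "solid_cone A" "a \<in> A" "a \<le> f"
  shows "blinfun_apply \<nu> a \<le> blinfun_apply (restrict_cone A \<nu>) f"
proof -
  have "0 \<le> f" using solid_coneD(2)[OF assms(1,2)] assms(3) by (rule order_trans)
  then show ?thesis
    using assms solid_cone_bdd_above[OF assms(1)]
    by (subst restrict_cone_apply) (auto intro!: cSup_upper)
qed

lemma restrict_cone_least:
  assumes "solid_cone A" "0 \<le> f" "\<And>a. a \<in> A \<Longrightarrow> a \<le> f \<Longrightarrow> blinfun_apply \<nu> a \<le> r"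
  shows "blinfun_apply (restrict_cone A \<nu>) f \<le> r"
  using assms solid_coneD(1)[OF assms(1)] by (subst restrict_cone_apply) (auto intro!: cSup_least)

lemma solid_cone_nonneg: "solid_cone {a::'a::banach_lattice. 0 \<le> a}"
  by (auto simp: solid_cone_def scaleR_nonneg_nonneg)

text \<open>\<open>|\<nu>| = 2 \<nu>\<^sup>+ - \<nu>\<close>, since \<open>|g| \<le> f\<close> iff \<open>0 \<le> f + g \<le> 2 f\<close>.\<close>

lemma dabs_exists:
  fixes \<nu> :: "'a::banach_lattice \<Rightarrow>\<^sub>L real"
  shows "\<exists>V :: 'a \<Rightarrow>\<^sub>L real. (\<forall>f\<ge>0. blinfun_apply V f = dabs_at \<nu> f) \<and> dle 0 V
    \<and> (\<forall>f. \<bar>blinfun_apply \<nu> f\<bar> \<le> blinfun_apply V (labs f))"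
proof -
  define P where "P = restrict_cone {a. 0 \<le> a} \<nu>"
  define V where "V = 2 *\<^sub>R P - \<nu>"
  have ub: "blinfun_apply \<nu> g \<le> blinfun_apply V f" if "labs g \<le> f" for f g
  proof -
    have fg: "g \<le> f" "- g \<le> f" using that by (auto simp: labs_le_iff)
    have "blinfun_apply \<nu> (f + g) \<le> blinfun_apply P (2 *\<^sub>R f)"
      unfolding P_def
    proof (rule restrict_cone_upper[OF solid_cone_nonneg])
      show "f + g \<in> {a. 0 \<le> a}" using fg(2) using add_right_mono[OF fg(2), of g] by simp
      show "f + g \<le> 2 *\<^sub>R f" using fg by (simp add: scaleR_2)
    qed
    then show ?thesis
      by (simp add: V_def blinfun.diff_left blinfun.scaleR_left blinfun.scaleR_right blinfun.add_right)
  qed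
  have lub: "blinfun_apply V f \<le> r"
    if f: "0 \<le> f" and r: "\<And>g. labs g \<le> f \<Longrightarrow> blinfun_apply \<nu> g \<le> r" for f r
  proof -
    have "blinfun_apply P (2 *\<^sub>R f) \<le> r + blinfun_apply \<nu> f"
      unfolding P_def
    proof (rule restrict_cone_least[OF solid_cone_nonneg])
      fix a assume "a \<in> {a. 0 \<le> a}" "a \<le> 2 *\<^sub>R f"
      then have "labs (a - f) \<le> f" by (auto simp: labs_le_iff scaleR_2 algebra_simps)
      from r[OF this] show "blinfun_apply \<nu> a \<le> r + blinfun_apply \<nu> f"
        by (simp add: blinfun.diff_right)
    qed (use f in \<open>simp add: scaleR_nonneg_nonneg\<close>)
    then show ?thesis
      by (simp add: V_def blinfun.diff_left blinfun.scaleR_left blinfun.scaleR_right)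
  qed
  have "blinfun_apply V f = dabs_at \<nu> f" if f: "0 \<le> f" for f
    unfolding dabs_at_def
  proof (rule antisym)
    let ?S = "{blinfun_apply \<nu> g |g. labs g \<le> f}"
    have bdd: "bdd_above ?S" using ub by (auto intro!: bdd_aboveI)
    show "blinfun_apply V f \<le> Sup ?S"
      by (rule lub[OF f]) (auto intro!: cSup_upper[OF _ bdd])
    show "Sup ?S \<le> blinfun_apply V f"
    proof (rule cSup_least)
      have "labs 0 \<le> f" using f by simp
      then show "?S \<noteq> {}" by blast
    qed (use ub in auto)
  qed
  moreover have "dle 0 V"
    using ub[of 0] by (simp add: dle_def)
  moreover have "\<bar>blinfun_apply \<nu> f\<bar> \<le> blinfun_apply V (labs f)" for f
    using ub[of f "labs f"] ub[of "- f" "labs f"] by (simp add: blinfun.minus_right)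
  ultimately show ?thesis by blast
qed

section \<open>Order continuity of the dual and disjoint sequences\<close>

text \<open>Directedness makes the sections of \<open>D\<close> a filter base, so one section
  decides.\<close>

lemma eventually_down_net:
  assumes D: "down_directed D"
  shows "eventually P (down_net D) \<longleftrightarrow> (\<exists>\<mu>\<in>D. \<forall>\<nu>\<in>D. dle \<nu> \<mu> \<longrightarrow> P \<nu>)"
  unfolding down_net_def
proof (subst eventually_INF_base)
  show "D \<noteq> {}" using D by (simp add: down_directed_def)
  fix \<mu> \<nu> assume "\<mu> \<in> D" "\<nu> \<in> D"
  then obtain \<kappa> where "\<kappa> \<in> D" "dle \<kappa> \<mu>" "dle \<kappa> \<nu>"
    using D unfolding down_directed_def by blast
  then show "\<exists>\<kappa>\<in>D. principal {\<nu> \<in> D. dle \<nu> \<kappa>} \<le> inf (principal {\<nu> \<in> D. dle \<nu> \<mu>}) (principal {\<kappa> \<in> D. dle \<kappa> \<nu>})"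
    by (intro bexI[of _ \<kappa>]) (auto simp: dle_def intro: order_trans)
qed (auto simp: eventually_principal)

lemma dle_0_mono:
  assumes "dle 0 V" "a \<le> b"
  shows "blinfun_apply V a \<le> blinfun_apply V b"
proof -
  have "0 \<le> blinfun_apply V (b - a)" using assms by (simp add: dle_def)
  then show ?thesis by (simp add: blinfun.diff_right)
qed

lemma dle_0_labs:
  assumes "dle 0 V"
  shows "\<bar>blinfun_apply V a\<bar> \<le> blinfun_apply V (labs a)"
  using dle_0_mono[OF assms labs_ge(1), of a] dle_0_mono[OF assms labs_ge(2), of a]
  by (simp add: blinfun.minus_right)

lemma solid_cone_ideal:
  assumes "0 \<le> (u :: 'a::banach_lattice)"
  shows "solid_cone {a. 0 \<le> a \<and> (\<exists>t\<ge>0. a \<le> t *\<^sub>R u)}"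
  unfolding solid_cone_def
proof (intro conjI ballI allI impI)
  fix a b assume "a \<in> {a. 0 \<le> a \<and> (\<exists>t\<ge>0. a \<le> t *\<^sub>R u)}" "b \<in> {a. 0 \<le> a \<and> (\<exists>t\<ge>0. a \<le> t *\<^sub>R u)}"
  then obtain s t where "0 \<le> a" "0 \<le> b" "0 \<le> s" "0 \<le> t" "a \<le> s *\<^sub>R u" "b \<le> t *\<^sub>R u" by blast
  then have "0 \<le> a + b" "0 \<le> s + t" "a + b \<le> (s + t) *\<^sub>R u"
    by (simp_all add: scaleR_left_distrib add_mono)
  then show "a + b \<in> {a. 0 \<le> a \<and> (\<exists>t\<ge>0. a \<le> t *\<^sub>R u)}"
    by (intro CollectI conjI exI[of _ "s + t"])
next
  fix a :: 'a and c :: real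
  assume "a \<in> {a. 0 \<le> a \<and> (\<exists>t\<ge>0. a \<le> t *\<^sub>R u)}" and c: "0 \<le> c"
  then obtain t where "0 \<le> a" "0 \<le> t" "a \<le> t *\<^sub>R u" by blast
  then have "0 \<le> c *\<^sub>R a" "0 \<le> c * t" "c *\<^sub>R a \<le> (c * t) *\<^sub>R u"
    using c scaleR_left_mono[of a "t *\<^sub>R u" c] by (simp_all add: scaleR_nonneg_nonneg)
  then show "c *\<^sub>R a \<in> {a. 0 \<le> a \<and> (\<exists>t\<ge>0. a \<le> t *\<^sub>R u)}"
    by (intro CollectI conjI exI[of _ "c * t"])
next
  fix a b :: 'a
  assume "a \<in> {a. 0 \<le> a \<and> (\<exists>t\<ge>0. a \<le> t *\<^sub>R u)}" and b: "0 \<le> b \<and> b \<le> a"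
  then obtain t where "0 \<le> t" "a \<le> t *\<^sub>R u" by blast
  then show "b \<in> {a. 0 \<le> a \<and> (\<exists>t\<ge>0. a \<le> t *\<^sub>R u)}"
    using b order_trans[of b a "t *\<^sub>R u"] by (intro CollectI conjI exI[of _ t]) simp_all
qed auto

lemma solid_cone_UN_mono:
  fixes A :: "nat \<Rightarrow> 'a::banach_lattice set"
  assumes A: "\<And>n. solid_cone (A n)" and mono: "\<And>m n. m \<le> n \<Longrightarrow> A m \<subseteq> A n"
  shows "solid_cone (\<Union>n. A n)"
  unfolding solid_cone_def
proof (intro conjI ballI allI impI)
  show "0 \<in> (\<Union>n. A n)" using solid_coneD(1)[OF A] by blast
next
  fix a assume "a \<in> (\<Union>n. A n)" then show "0 \<le> a" using solid_coneD(2)[OF A] by blast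
next
  fix a b assume "a \<in> (\<Union>n. A n)" "b \<in> (\<Union>n. A n)"
  then obtain m n where "a \<in> A m" "b \<in> A n" by blast
  then have "a \<in> A (max m n)" "b \<in> A (max m n)"
    using mono[of m "max m n"] mono[of n "max m n"] by auto
  then show "a + b \<in> (\<Union>n. A n)" using solid_coneD(3)[OF A] by blast
next
  fix a :: 'a and c :: real assume "a \<in> (\<Union>n. A n)" "0 \<le> c"
  then show "c *\<^sub>R a \<in> (\<Union>n. A n)" using solid_coneD(4)[OF A] by blast
next
  fix a b :: 'a assume "a \<in> (\<Union>n. A n)" "0 \<le> b \<and> b \<le> a"
  then show "b \<in> (\<Union>n. A n)" using solid_coneD(5)[OF A] by blast
qed

lemma restrict_cone_mono:
  assumes "solid_cone A" "solid_cone B" "A \<subseteq> B"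
  shows "dle (restrict_cone A V) (restrict_cone B V)"
  unfolding dle_def
proof (intro allI impI)
  fix f :: 'a assume "0 \<le> f"
  then show "blinfun_apply (restrict_cone A V) f \<le> blinfun_apply (restrict_cone B V) f"
    using assms by (intro restrict_cone_least restrict_cone_upper) auto
qed

text \<open>Let \<open>Q\<^sub>N\<close> and \<open>Q\<close> be the components of \<open>|\<nu>|\<close> carried by the ideals generated by the first
  \<open>N\<close> terms and by all terms of \<open>x\<close>.  Then \<open>Q - Q\<^sub>N\<close> decreases to \<open>0\<close>, hence in norm, and
  \<open>(Q - Q\<^sub>N) |x\<^sub>m| \<ge> |\<nu>| |x\<^sub>m|\<close> for \<open>m \<ge> N\<close>.\<close>

lemma dual_oc_part_disjoint_null:
  fixes x :: "nat \<Rightarrow> 'a::banach_lattice"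
  assumes \<nu>: "\<nu> \<in> dual_oc_part" and bdd: "bounded (range x)" and disj: "disjoint_seq x"
  shows "(\<lambda>n. blinfun_apply \<nu> (labs (x n))) \<longlonglongrightarrow> 0"
proof -
  obtain V where V: "\<And>f. 0 \<le> f \<Longrightarrow> blinfun_apply V f = dabs_at \<nu> f" and V0: "dle 0 V"
    and \<nu>V: "\<And>f. \<bar>blinfun_apply \<nu> f\<bar> \<le> blinfun_apply V (labs f)"
    using dabs_exists[of \<nu>] by blast
  define y where "y n = labs (x n)" for n
  have y0: "0 \<le> y n" for n by (simp add: y_def)
  define s where "s N = (\<Sum>n<N. y n)" for N
  have s0: "0 \<le> s N" for N by (simp add: s_def sum_nonneg y0)
  have s_mono: "s M \<le> s N" if "M \<le> N" for M N
    unfolding s_def using that y0 by (intro sum_mono2) auto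
  define A where "A N = {a. 0 \<le> a \<and> (\<exists>t\<ge>0. a \<le> t *\<^sub>R s N)}" for N
  have A: "solid_cone (A N)" for N
    unfolding A_def by (rule solid_cone_ideal[OF s0])
  have A_mono: "A M \<subseteq> A N" if "M \<le> N" for M N
    unfolding A_def using scaleR_left_mono[OF s_mono[OF that]] by (auto intro: order_trans)
  define B where "B = (\<Union>N. A N)"
  have B: "solid_cone B"
    unfolding B_def by (rule solid_cone_UN_mono[OF A A_mono])
  define Q where "Q N = restrict_cone B V - restrict_cone (A N) V" for N
  have Q_apply: "blinfun_apply (Q N) f
      = blinfun_apply (restrict_cone B V) f - blinfun_apply (restrict_cone (A N) V) f" for N f
    by (simp add: Q_def blinfun.diff_left)
  have Q_anti: "dle (Q N) (Q M)" if "M \<le> N" for M N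
    using restrict_cone_mono[OF A A A_mono[OF that], of V] by (simp add: dle_def Q_apply)
  have Q_pos: "dle 0 (Q N)" for N
    using restrict_cone_mono[OF A B, of N V] by (auto simp: dle_def Q_apply B_def)
  have dir: "down_directed (range Q)"
    unfolding down_directed_def
  proof (intro conjI ballI)
    fix \<mu> \<kappa> assume "\<mu> \<in> range Q" "\<kappa> \<in> range Q"
    then obtain M N where "\<mu> = Q M" "\<kappa> = Q N" by blast
    then show "\<exists>\<rho>\<in>range Q. dle \<rho> \<mu> \<and> dle \<rho> \<kappa>"
      using Q_anti[of M "max M N"] Q_anti[of N "max M N"] by auto
  qed simp
  have inf0: "dinf_zero (range Q)"
    unfolding dinf_zero_def
  proof (intro conjI allI impI ballI)
    fix \<mu> assume "\<mu> \<in> range Q" then show "dle 0 \<mu>" using Q_pos by blast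
  next
    fix \<kappa> assume "\<forall>\<mu>\<in>range Q. dle \<kappa> \<mu>"
    then have \<kappa>: "blinfun_apply \<kappa> f + blinfun_apply (restrict_cone (A N) V) f \<le> blinfun_apply (restrict_cone B V) f"
      if "0 \<le> f" for f N
      using that by (force simp: dle_def Q_apply algebra_simps)
    have "blinfun_apply \<kappa> f \<le> 0" if f: "0 \<le> f" for f
    proof -
      \<comment> \<open>The supremum for \<open>B\<close> runs over the union of the
        \<open>A N\<close>, and \<kappa> fits into every gap \<open>Q N\<close>; hence the value
        lowered by \<kappa> f is still an upper bound.\<close>
      have "blinfun_apply (restrict_cone B V) f \<le> blinfun_apply (restrict_cone B V) f - blinfun_apply \<kappa> f"
      proof (rule restrict_cone_least[OF B f])
        fix a assume "a \<in> B" "a \<le> f"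
        then obtain N where "a \<in> A N" by (auto simp: B_def)
        then have "blinfun_apply V a \<le> blinfun_apply (restrict_cone (A N) V) f"
          by (rule restrict_cone_upper[OF A _ \<open>a \<le> f\<close>])
        then show "blinfun_apply V a \<le> blinfun_apply (restrict_cone B V) f - blinfun_apply \<kappa> f"
          using \<kappa>[OF f, of N] by simp
      qed
      then show ?thesis by simp
    qed
    then show "dle \<kappa> 0" by (simp add: dle_def)
  qed
  have le: "blinfun_apply \<mu> f \<le> dabs_at \<nu> f" if "\<mu> \<in> range Q" "0 \<le> f" for \<mu> f
  proof -
    obtain N where \<mu>: "\<mu> = Q N" using \<open>\<mu> \<in> range Q\<close> by blast
    have "blinfun_apply (restrict_cone B V) f \<le> blinfun_apply V f"
      by (rule restrict_cone_least[OF B that(2)]) (rule dle_0_mono[OF V0])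
    moreover have "0 \<le> blinfun_apply (restrict_cone (A N) V) f"
      using restrict_cone_upper[OF A solid_coneD(1)[OF A] that(2), of V N] by simp
    ultimately show ?thesis
      by (simp add: \<mu> Q_apply V[OF that(2), symmetric])
  qed
  have lim: "((\<lambda>\<mu>. norm \<mu>) \<longlongrightarrow> 0) (down_net (range Q))"
    using \<nu> dir inf0 le unfolding dual_oc_part_def by blast
  obtain C where C: "0 < C" "\<And>n. norm (x n) \<le> C"
    using bdd unfolding bounded_pos by auto
  show ?thesis
  proof (rule LIMSEQ_I)
    fix e :: real assume "0 < e"
    then have "\<forall>\<^sub>F \<mu> in down_net (range Q). norm \<mu> < e / C"
      using order_tendstoD(2)[OF lim, of "e / C"] C by simp
    then obtain N where N: "norm (Q N) < e / C"
      unfolding eventually_down_net[OF dir] by (auto simp: dle_def)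
    have "norm (blinfun_apply \<nu> (labs (x m)) - 0) < e" if "N \<le> m" for m
    proof -
      \<comment> \<open>For m \<ge> N the vector \<open>y m\<close> is disjoint from
        \<open>s N\<close>, so only 0 lies both in \<open>A N\<close> and below
        \<open>y m\<close>.\<close>
      have "blinfun_apply (restrict_cone (A N) V) (y m) \<le> 0"
      proof (rule restrict_cone_least[OF A y0])
        fix a assume "a \<in> A N" and am: "a \<le> y m"
        then obtain t where t: "0 \<le> a" "0 \<le> t" "a \<le> t *\<^sub>R s N" by (auto simp: A_def)
        have "inf (s N) (y m) = 0"
          unfolding s_def using disj that
          by (intro inf_sum_eq_0) (auto simp: y0 y_def disjoint_seq_def)
        then have "inf (t *\<^sub>R s N) (y m) = 0"
          by (intro inf_scaleR_eq_0) (auto simp: s0 y0 t)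
        then have "a \<le> 0" using t am by (metis inf_greatest)
        then have "a = 0" using t by simp
        then show "blinfun_apply V a \<le> 0" by simp
      qed
      moreover have "y m \<in> B"
        unfolding B_def A_def
      \<comment> \<open>\<open>s N\<close> sums the indices below N, so \<open>y m\<close> first
        occurs in \<open>s (Suc m)\<close>.\<close>
      proof (intro UN_I[of "Suc m"] CollectI conjI exI[of _ 1])
        show "y m \<le> 1 *\<^sub>R s (Suc m)"
          using s0[of m] by (simp add: s_def)
      qed (simp_all add: y0)
      then have "blinfun_apply V (y m) \<le> blinfun_apply (restrict_cone B V) (y m)"
        by (rule restrict_cone_upper[OF B]) simp
      ultimately have "blinfun_apply V (y m) \<le> blinfun_apply (Q N) (y m)"
        by (simp add: Q_apply)
      also have "\<dots> \<le> norm (Q N) * C"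
        using blinfun_le_norm[of "Q N" "y m"] mult_left_mono[OF C(2)[of m], of "norm (Q N)"]
        by (simp add: y_def)
      also have "\<dots> < e" using N C by (simp add: field_simps)
      finally show ?thesis using \<nu>V[of "y m"] by (simp add: y_def)
    qed
    then show "\<exists>N. \<forall>m\<ge>N. norm (blinfun_apply \<nu> (labs (x m)) - 0) < e" by blast
  qed
qed

section \<open>Almost order boundedness of the unit ball\<close>

lemma suminf_ge_term:
  fixes f :: "nat \<Rightarrow> 'a::banach_lattice"
  assumes f: "summable f" and pos: "\<And>n. 0 \<le> f n"
  shows "f i \<le> suminf f"
proof -
  have "(\<lambda>n. (\<Sum>k<n. f k) - f i) \<longlonglongrightarrow> suminf f - f i"
    by (intro tendsto_intros summable_LIMSEQ f)
  moreover have "\<forall>\<^sub>F n in sequentially. (\<Sum>k<n. f k) - f i \<in> {z. 0 \<le> z}"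
  proof (rule eventually_sequentiallyI[of "Suc i"])
    fix n assume "Suc i \<le> n"
    then have "f i \<le> (\<Sum>k<n. f k)"
      using sum_mono2[of "{..<n}" "{i}" f] pos by simp
    then show "(\<Sum>k<n. f k) - f i \<in> {z. 0 \<le> z}" by simp
  qed
  ultimately have "suminf f - f i \<in> {z. 0 \<le> z}"
    by (intro Lim_in_closed_set[OF closed_nonneg _ sequentially_bot])
  then show ?thesis by simp
qed

lemma inf_pprt_scaled:
  fixes a b :: "'a::banach_lattice"
  assumes "0 \<le> t"
  shows "inf (pprt (a - t *\<^sub>R b)) (pprt (t *\<^sub>R b - a)) = 0"
  using inf_pprt_pprt_minus[of "a - t *\<^sub>R b"] by simp

text \<open>If the unit ball is not almost order bounded with respect to \<open>\<nu>\<close>, pick \<open>x\<^sub>n\<^sub>+\<^sub>1\<close> with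
  \<open>\<nu> ((x\<^sub>n\<^sub>+\<^sub>1 - 4\<^sup>n \<Sum>\<^sub>i\<^sub>\<le>\<^sub>n x\<^sub>i)\<^sup>+) > e\<close>; subtracting further \<open>2\<^sup>-\<^sup>n w\<close>, \<open>w = \<Sum> 2\<^sup>-\<^sup>i x\<^sub>i\<close>, inside the
  positive part makes these vectors disjoint at a vanishing cost.\<close>

lemma almost_order_bounded:
  fixes \<nu> :: "'a::banach_lattice \<Rightarrow>\<^sub>L real"
  assumes null: "\<And>x :: nat \<Rightarrow> 'a. bounded (range x) \<Longrightarrow> disjoint_seq x \<Longrightarrow> (\<lambda>n. blinfun_apply \<nu> (labs (x n))) \<longlonglongrightarrow> 0"
    and \<nu>: "dle 0 \<nu>" and e: "0 < e"
  shows "\<exists>u\<ge>0. \<forall>x. 0 \<le> x \<and> norm x \<le> 1 \<longrightarrow> blinfun_apply \<nu> (pprt (x - u)) \<le> e"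
proof (rule ccontr)
  assume "\<not> ?thesis"
  then have "\<forall>u. 0 \<le> u \<longrightarrow> (\<exists>x. 0 \<le> x \<and> norm x \<le> 1 \<and> e < blinfun_apply \<nu> (pprt (x - u)))"
    by (meson not_le)
  then obtain c where c: "\<And>u. 0 \<le> u \<Longrightarrow> 0 \<le> c u" "\<And>u. 0 \<le> u \<Longrightarrow> norm (c u) \<le> 1"
      "\<And>u. 0 \<le> u \<Longrightarrow> e < blinfun_apply \<nu> (pprt (c u - u))"
    by metis
  \<comment> \<open>\<open>S n\<close> is the sum of x_0, ..., x_n. The next term is chosen from
    this sum alone, so the recursion can run on the sums.\<close>
  define S where "S = rec_nat (c 0) (\<lambda>n s. s + c (4 ^ n *\<^sub>R s))"
  have S_0: "S 0 = c 0" and S_Suc: "S (Suc n) = S n + c (4 ^ n *\<^sub>R S n)" for n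
    by (simp_all add: S_def)
  have S_pos: "0 \<le> S n" for n
    by (induction n) (simp_all add: S_0 S_Suc c(1) scaleR_nonneg_nonneg)
  define x where "x n = (case n of 0 \<Rightarrow> c 0 | Suc m \<Rightarrow> c (4 ^ m *\<^sub>R S m))" for n
  have x_Suc: "x (Suc n) = c (4 ^ n *\<^sub>R S n)" for n by (simp add: x_def)
  have uS: "0 \<le> 4 ^ n *\<^sub>R S n" for n by (simp add: S_pos scaleR_nonneg_nonneg)
  have x_pos: "0 \<le> x n" and x_norm: "norm (x n) \<le> 1" for n
    by (cases n; simp add: x_def c uS)+
  have x_le_S: "x i \<le> S n" if "i \<le> n" for i n
    using that
  proof (induction n)
    case (Suc n)
    show ?case
    proof (cases "i = Suc n")
      case True then show ?thesis using S_pos[of n] by (simp add: S_Suc x_Suc)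
    next
      case False
      then have "x i \<le> S n" using Suc by simp
      then show ?thesis using c(1)[OF uS, of n] by (simp add: S_Suc add_increasing2)
    qed
  qed (simp add: S_0 x_def)
  define w where "w = (\<Sum>i. (1/2) ^ i *\<^sub>R x i)"
  have "summable (\<lambda>i. (1/2) ^ i *\<^sub>R x i)"
  proof (rule summable_comparison_test[OF _ summable_geometric[of "1/2::real"]])
    show "\<exists>N. \<forall>n\<ge>N. norm ((1/2) ^ n *\<^sub>R x n) \<le> (1/2) ^ n"
      using x_norm by (auto intro!: mult_left_le)
  qed simp
  then have w: "(1/2) ^ i *\<^sub>R x i \<le> w" for i
    unfolding w_def by (rule suminf_ge_term) (simp add: x_pos scaleR_nonneg_nonneg)
  have w_pos: "0 \<le> w" using w[of 0] x_pos[of 0] by simp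
  have hw_pos: "0 \<le> (1/2) ^ n *\<^sub>R w" for n :: nat using w_pos by (simp add: scaleR_nonneg_nonneg)
  \<comment> \<open>The multiple of \<open>S n\<close> separates \<open>u n\<close> from the earlier
    terms, the multiple of \<open>w\<close> from the later ones.\<close>
  define u where "u n = pprt (x (Suc n) - 4 ^ n *\<^sub>R S n - (1/2) ^ n *\<^sub>R w)" for n
  have u_pos: "0 \<le> u n" for n by (simp add: u_def)
  have u_le: "u n \<le> x (Suc n)" for n
  proof -
    have "x (Suc n) - 4 ^ n *\<^sub>R S n - (1/2) ^ n *\<^sub>R w \<le> x (Suc n) - 0 - 0"
      by (intro diff_mono order_refl uS hw_pos)
    from pprt_mono[OF this] show ?thesis by (simp add: u_def x_pos)
  qed
  \<comment> \<open>With t = 4^n, a = x_(n+1) and b = x_(m+1), the vector \<open>u n\<close> lies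
    below (a - t b)^+ and \<open>u m\<close> below (1/t) (t b - a)^+; these are disjoint.\<close>
  have disj: "inf (u m) (u n) = 0" if "m < n" for m n
  proof -
    let ?t = "4 ^ n :: real"
    have "?t *\<^sub>R x (Suc m) \<le> ?t *\<^sub>R S n"
      using that by (intro scaleR_left_mono x_le_S) auto
    then have "x (Suc n) - ?t *\<^sub>R S n - (1/2) ^ n *\<^sub>R w \<le> x (Suc n) - ?t *\<^sub>R x (Suc m) - 0"
      by (intro diff_mono order_refl hw_pos)
    from pprt_mono[OF this] have un: "u n \<le> pprt (x (Suc n) - ?t *\<^sub>R x (Suc m))"
      by (simp add: u_def)
    have "(1/2) ^ m *\<^sub>R ((1/2) ^ Suc n *\<^sub>R x (Suc n)) \<le> (1/2) ^ m *\<^sub>R w"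
      by (intro scaleR_left_mono w) simp
    moreover have "inverse ?t *\<^sub>R x (Suc n) \<le> (1/2) ^ m *\<^sub>R ((1/2) ^ Suc n *\<^sub>R x (Suc n))"
    proof -
      have "(1/2 :: real) ^ (2 * n) = ((1/2)\<^sup>2) ^ n" by (rule power_mult)
      also have "\<dots> = inverse ?t" by (simp add: power2_eq_square power_one_over inverse_eq_divide)
      finally have "inverse ?t = (1/2) ^ (2 * n)" ..
      \<comment> \<open>Here m < n gives m + n + 1 \<le> 2 n; this is why the factor 4^n is paired
        with weights 2^-n.\<close>
      also have "\<dots> \<le> (1/2) ^ (m + Suc n)" using that by (intro power_decreasing) auto
      finally show ?thesis
        unfolding scaleR_scaleR power_add[symmetric] by (rule scaleR_right_mono[OF _ x_pos])
    qed
    ultimately have "inverse ?t *\<^sub>R x (Suc n) \<le> (1/2) ^ m *\<^sub>R w" by simp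
    then have "x (Suc m) - 4 ^ m *\<^sub>R S m - (1/2) ^ m *\<^sub>R w \<le> x (Suc m) - 0 - inverse ?t *\<^sub>R x (Suc n)"
      by (intro diff_mono order_refl uS)
    also have "\<dots> = inverse ?t *\<^sub>R (?t *\<^sub>R x (Suc m) - x (Suc n))"
      by (simp add: scaleR_right_diff_distrib)
    finally have "u m \<le> pprt (inverse ?t *\<^sub>R (?t *\<^sub>R x (Suc m) - x (Suc n)))"
      unfolding u_def by (rule pprt_mono)
    also have "\<dots> = inverse ?t *\<^sub>R pprt (?t *\<^sub>R x (Suc m) - x (Suc n))"
      by (rule pprt_scaleR) simp
    finally have um: "u m \<le> inverse ?t *\<^sub>R pprt (?t *\<^sub>R x (Suc m) - x (Suc n))" .
    have "inf (inverse ?t *\<^sub>R pprt (?t *\<^sub>R x (Suc m) - x (Suc n))) (pprt (x (Suc n) - ?t *\<^sub>R x (Suc m))) = 0"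
      using inf_pprt_scaled[of ?t "x (Suc n)" "x (Suc m)"]
      by (intro inf_scaleR_eq_0) (simp_all add: inf_commute)
    from inf_eq_0_mono[OF this u_pos um u_pos un] show ?thesis .
  qed
  have "disjoint_seq u"
    unfolding disjoint_seq_def
  proof (intro allI impI)
    fix m n :: nat assume "m \<noteq> n"
    then show "inf (labs (u m)) (labs (u n)) = 0"
      using disj[of m n] disj[of n m] by (auto simp: labs_of_nonneg u_pos inf_commute neq_iff)
  qed
  moreover have "bounded (range u)"
    unfolding bounded_iff
    using norm_mono_nonneg[OF u_pos u_le] x_norm by (auto intro!: exI[of _ 1] intro: order_trans)
  ultimately have lim: "(\<lambda>n. blinfun_apply \<nu> (u n)) \<longlonglongrightarrow> 0"
    using null[of u] by (simp add: labs_of_nonneg u_pos)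
  \<comment> \<open>Subtracting a multiple of \<open>w\<close> inside the positive part lowers \<nu>
    by at most \<nu> of that multiple, which tends to 0.\<close>
  have "e \<le> blinfun_apply \<nu> (u n) + (1/2) ^ n * blinfun_apply \<nu> w" for n
  proof -
    have "x (Suc n) - 4 ^ n *\<^sub>R S n \<le> u n + (1/2) ^ n *\<^sub>R w"
      unfolding u_def pprt_def by (simp flip: diff_le_eq)
    moreover have "0 \<le> u n + (1/2) ^ n *\<^sub>R w"
      using u_pos hw_pos by simp
    ultimately have "pprt (x (Suc n) - 4 ^ n *\<^sub>R S n) \<le> u n + (1/2) ^ n *\<^sub>R w"
      unfolding pprt_def by simp
    from dle_0_mono[OF \<nu> this] c(3)[OF uS, of n] show ?thesis
      by (simp add: x_Suc blinfun.add_right blinfun.scaleR_right)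
  qed
  moreover have "(\<lambda>n. blinfun_apply \<nu> (u n) + (1/2) ^ n * blinfun_apply \<nu> w) \<longlonglongrightarrow> 0 + 0 * blinfun_apply \<nu> w"
    by (intro tendsto_intros lim LIMSEQ_power_zero) simp
  ultimately have "e \<le> 0 + 0 * blinfun_apply \<nu> w"
    by (intro LIMSEQ_le_const) auto
  then show False using e by simp
qed

text \<open>The pointwise infimum over a directed set is additive on the cone, hence extends to a
  functional below all of \<open>D\<close>; such a functional is at most 0.\<close>

lemma dinf_zero_pointwise:
  fixes D :: "('a::banach_lattice \<Rightarrow>\<^sub>L real) set"
  assumes dir: "down_directed D" and zero: "dinf_zero D" and f: "0 \<le> f" and e: "0 < e"
  shows "\<exists>\<mu>\<in>D. blinfun_apply \<mu> f < e"
proof -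
  define p where "p f = (INF \<mu>\<in>D. blinfun_apply \<mu> f)" for f
  have ne: "D \<noteq> {}" using dir by (simp add: down_directed_def)
  have pos: "0 \<le> blinfun_apply \<mu> g" if "\<mu> \<in> D" "0 \<le> g" for \<mu> g
    using zero that by (auto simp: dinf_zero_def dle_def)
  have p_le: "p g \<le> blinfun_apply \<mu> g" if "\<mu> \<in> D" "0 \<le> g" for \<mu> g
    unfolding p_def using that pos by (intro cINF_lower) (auto intro!: bdd_belowI)
  have p_ge: "r \<le> p g" if "\<And>\<mu>. \<mu> \<in> D \<Longrightarrow> r \<le> blinfun_apply \<mu> g" for r g
    unfolding p_def using that by (intro cINF_greatest ne)
  obtain \<mu>0 where \<mu>0: "\<mu>0 \<in> D" using ne by blast
  have "\<exists>\<kappa> :: 'a \<Rightarrow>\<^sub>L real. \<forall>g\<ge>0. blinfun_apply \<kappa> g = p g"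
  proof (rule blinfun_extend_positive_cone[where C = "norm \<mu>0"])
    fix g :: 'a assume g: "0 \<le> g"
    show "\<bar>p g\<bar> \<le> norm \<mu>0 * norm g"
      using p_le[OF \<mu>0 g] p_ge[of 0 g] pos[OF _ g] blinfun_le_norm[of \<mu>0 g] by force
    {
      fix h :: 'a assume h: "0 \<le> h"
      have "p g + p h \<le> p (g + h)"
        by (rule p_ge) (simp add: blinfun.add_right add_mono p_le g h)
      \<comment> \<open>The infima at g and at h may be approached by different members;
        directedness supplies one member below both.\<close>
      moreover have "p (g + h) - blinfun_apply \<mu> h \<le> p g" if \<mu>: "\<mu> \<in> D" for \<mu>
      proof (rule p_ge)
        fix \<nu> assume "\<nu> \<in> D"
        then obtain \<kappa> where "\<kappa> \<in> D" "dle \<kappa> \<mu>" "dle \<kappa> \<nu>"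
          using dir \<mu> unfolding down_directed_def by blast
        then show "p (g + h) - blinfun_apply \<mu> h \<le> blinfun_apply \<nu> g"
          using p_le[of \<kappa> "g + h"] g h by (force simp: dle_def blinfun.add_right)
      qed
      then have "p (g + h) - p g \<le> p h"
        by (intro p_ge) (force simp: algebra_simps)
      ultimately show "p (g + h) = p g + p h" by simp
    }
    {
      fix c :: real assume c: "0 < c"
      have "c * p g \<le> p (c *\<^sub>R g)"
        using c p_le g by (intro p_ge) (simp add: blinfun.scaleR_right)
      moreover have "p (c *\<^sub>R g) / c \<le> p g"
      proof (rule p_ge)
        fix \<mu> assume "\<mu> \<in> D"
        then show "p (c *\<^sub>R g) / c \<le> blinfun_apply \<mu> g"
          using p_le[of \<mu> "c *\<^sub>R g"] c g
          by (simp add: blinfun.scaleR_right scaleR_nonneg_nonneg field_simps)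
      qed
      ultimately show "p (c *\<^sub>R g) = c * p g"
        using c by (simp add: field_simps)
    }
  qed
  then obtain \<kappa> :: "'a \<Rightarrow>\<^sub>L real" where \<kappa>: "\<And>g. 0 \<le> g \<Longrightarrow> blinfun_apply \<kappa> g = p g" by blast
  have "\<forall>\<mu>\<in>D. dle \<kappa> \<mu>" by (simp add: dle_def \<kappa> p_le)
  then have "dle \<kappa> 0" using zero unfolding dinf_zero_def by blast
  then have "p f \<le> 0" using \<kappa>[OF f] f by (auto simp: dle_def)
  then have "p f < e" using e by simp
  moreover have bdd: "bdd_below ((\<lambda>\<mu>. blinfun_apply \<mu> f) ` D)"
    using pos[OF _ f] by (rule bdd_belowI2)
  ultimately show ?thesis
    unfolding p_def using cINF_less_iff[OF ne bdd] by blast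
qed

lemma disjoint_null_imp_dual_order_continuous:
  assumes null: "\<And>(x :: nat \<Rightarrow> 'a::banach_lattice) \<nu> :: 'a \<Rightarrow>\<^sub>L real. bounded (range x) \<Longrightarrow> disjoint_seq x
      \<Longrightarrow> (\<lambda>n. blinfun_apply \<nu> (labs (x n))) \<longlonglongrightarrow> 0"
  shows "dual_order_continuous TYPE('a)"
  unfolding dual_order_continuous_def
proof (intro allI impI)
  fix D :: "('a \<Rightarrow>\<^sub>L real) set" assume "down_directed D \<and> dinf_zero D"
  then have dir: "down_directed D" and zero: "dinf_zero D" by auto
  obtain \<mu>0 where \<mu>0: "\<mu>0 \<in> D" using dir by (auto simp: down_directed_def)
  have pos: "dle 0 \<mu>" if "\<mu> \<in> D" for \<mu> using zero that by (auto simp: dinf_zero_def)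
  show "((\<lambda>\<mu>. norm \<mu>) \<longlongrightarrow> 0) (down_net D)"
  proof (rule tendstoI)
    fix e :: real assume e: "0 < e"
    \<comment> \<open>One quarter of e goes to the part outside the order interval and one to the
      value at \<open>u\<close>; the total e/2 leaves room for strictness.\<close>
    obtain u where u: "0 \<le> u" "\<And>x. 0 \<le> x \<Longrightarrow> norm x \<le> 1 \<Longrightarrow> blinfun_apply \<mu>0 (pprt (x - u)) \<le> e / 4"
      using almost_order_bounded[of \<mu>0 "e / 4", OF null pos[OF \<mu>0]] e by auto
    obtain \<mu>1 where \<mu>1: "\<mu>1 \<in> D" "blinfun_apply \<mu>1 u < e / 4"
      using dinf_zero_pointwise[OF dir zero u(1), of "e / 4"] e by auto
    obtain \<kappa> where \<kappa>: "\<kappa> \<in> D" "dle \<kappa> \<mu>0" "dle \<kappa> \<mu>1"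
      using dir \<mu>0 \<mu>1(1) unfolding down_directed_def by blast
    have "norm \<nu> < e" if \<nu>: "\<nu> \<in> D" "dle \<nu> \<kappa>" for \<nu>
    proof -
      have le0: "blinfun_apply \<nu> f \<le> blinfun_apply \<mu>0 f"
        and le1: "blinfun_apply \<nu> f \<le> blinfun_apply \<mu>1 f" if "0 \<le> f" for f
        using \<nu>(2) \<kappa>(2,3) that unfolding dle_def by (meson order_trans)+
      have "norm \<nu> \<le> e / 2"
      proof (rule norm_blinfun_bound)
        fix x :: 'a
        show "norm (blinfun_apply \<nu> x) \<le> e / 2 * norm x"
        proof (cases "x = 0")
          case False
          define y where "y = labs x /\<^sub>R norm x"
          have y: "0 \<le> y" "norm y \<le> 1"
            using False by (simp_all add: y_def scaleR_nonneg_nonneg)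
          have "y \<le> u + pprt (y - u)"
            unfolding pprt_def by (metis add.commute diff_le_eq sup_ge1)
          then have "blinfun_apply \<nu> y \<le> blinfun_apply \<nu> u + blinfun_apply \<nu> (pprt (y - u))"
            using dle_0_mono[OF pos[OF \<nu>(1)]] by (metis blinfun.add_right)
          also have "blinfun_apply \<nu> u \<le> e / 4"
            using le1[OF u(1)] \<mu>1(2) by simp
          also have "blinfun_apply \<nu> (pprt (y - u)) \<le> blinfun_apply \<mu>0 (pprt (y - u))"
            by (rule le0) simp
          also have "\<dots> \<le> e / 4" by (rule u(2)[OF y])
          finally have "blinfun_apply \<nu> y \<le> e / 2" by simp
          then have "blinfun_apply \<nu> (labs x) \<le> e / 2 * norm x"
            using False by (simp add: y_def blinfun.scaleR_right field_simps)
          then show ?thesis using dle_0_labs[OF pos[OF \<nu>(1)], of x] by simp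
        qed simp
      qed (use e in simp)
      then show ?thesis using e by simp
    qed
    then show "\<forall>\<^sub>F \<mu> in down_net D. dist (norm \<mu>) 0 < e"
      unfolding eventually_down_net[OF dir] using \<kappa>(1) by auto
  qed
qed

section \<open>Hahn--Banach and quotient maps\<close>

definition sublinear :: "('a::real_vector \<Rightarrow> real) \<Rightarrow> bool" where
  "sublinear q \<longleftrightarrow> (\<forall>x y. q (x + y) \<le> q x + q y) \<and> (\<forall>c>0. \<forall>x. q (c *\<^sub>R x) = c * q x)"

lemma sublinearD:
  assumes "sublinear q"
  shows "q (x + y) \<le> q x + q y" "0 \<le> c \<Longrightarrow> q (c *\<^sub>R x) = c * q x" "q 0 = 0" "- q (- x) \<le> q x"
proof -
  show add: "q (x + y) \<le> q x + q y" for x y using assms by (simp add: sublinear_def)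
  have scale: "q (c *\<^sub>R x) = c * q x" if "0 < c" for c x using assms that by (simp add: sublinear_def)
  show z: "q 0 = 0" using scale[of 2 0] by simp
  show "0 \<le> c \<Longrightarrow> q (c *\<^sub>R x) = c * q x" using scale z by (cases "c = 0") auto
  show "- q (- x) \<le> q x" using add[of x "- x"] z by simp
qed

lemma sublinearI:
  assumes add: "\<And>x y. q (x + y) \<le> q x + q y"
    and le: "\<And>c x. 0 < c \<Longrightarrow> q (c *\<^sub>R x) \<le> c * q x"
  shows "sublinear q"
  unfolding sublinear_def
proof (intro conjI allI impI add)
  fix c :: real and x assume c: "0 < c"
  then have "q (inverse c *\<^sub>R (c *\<^sub>R x)) \<le> inverse c * q (c *\<^sub>R x)" by (intro le) simp
  then have "c * q x \<le> q (c *\<^sub>R x)" using c by (simp add: field_simps)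
  then show "q (c *\<^sub>R x) = c * q x" using le[OF c, of x] by simp
qed

text \<open>Take r x = inf over t \<ge> 0 of q (x + t y) - t q y, which is at least - q (- x). The
  value t = 0 gives r \<le> q, and t = 1 gives the last inequality.\<close>

lemma sublinear_descent:
  assumes q: "sublinear q"
  shows "\<exists>r. sublinear r \<and> r \<le> q \<and> (\<forall>x. r x \<le> q (x + y) - q y)"
proof -
  define r where "r x = (INF t\<in>{0..}. q (x + t *\<^sub>R y) - t * q y)" for x
  have lower: "- q (- x) \<le> q (x + t *\<^sub>R y) - t * q y" if "0 \<le> t" for x t
    using sublinearD(1)[OF q, of "x + t *\<^sub>R y" "- x"] sublinearD(2)[OF q that, of y] by simp
  have r_le: "r x \<le> q (x + t *\<^sub>R y) - t * q y" if "0 \<le> t" for x t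
    unfolding r_def using that lower by (intro cINF_lower) (auto intro!: bdd_belowI2)
  have r_ge: "s \<le> r x" if "\<And>t. 0 \<le> t \<Longrightarrow> s \<le> q (x + t *\<^sub>R y) - t * q y" for s x
    unfolding r_def using that by (intro cINF_greatest) auto
  have "sublinear r"
  proof (rule sublinearI)
    fix x z
    have "r (x + z) - (q (x + s *\<^sub>R y) - s * q y) \<le> r z" if s: "0 \<le> s" for s
    proof (rule r_ge)
      fix t :: real assume t: "0 \<le> t"
      have "r (x + z) \<le> q ((x + z) + (s + t) *\<^sub>R y) - (s + t) * q y"
        using s t by (intro r_le) simp
      also have "(x + z) + (s + t) *\<^sub>R y = (x + s *\<^sub>R y) + (z + t *\<^sub>R y)"
        by (simp add: algebra_simps)
      also have "q \<dots> \<le> q (x + s *\<^sub>R y) + q (z + t *\<^sub>R y)" by (rule sublinearD(1)[OF q])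
      finally show "r (x + z) - (q (x + s *\<^sub>R y) - s * q y) \<le> q (z + t *\<^sub>R y) - t * q y"
        by (simp add: algebra_simps)
    qed
    then have "r (x + z) - r z \<le> r x"
      by (intro r_ge) (force simp: algebra_simps)
    then show "r (x + z) \<le> r x + r z" by simp
  next
    fix c :: real and x assume c: "0 < c"
    have "r (c *\<^sub>R x) / c \<le> r x"
    proof (rule r_ge)
      fix t :: real assume t: "0 \<le> t"
      have "r (c *\<^sub>R x) \<le> q (c *\<^sub>R x + (c * t) *\<^sub>R y) - (c * t) * q y"
        using c t by (intro r_le) simp
      also have "c *\<^sub>R x + (c * t) *\<^sub>R y = c *\<^sub>R (x + t *\<^sub>R y)" by (simp add: algebra_simps)
      also have "q \<dots> = c * q (x + t *\<^sub>R y)" using sublinearD(2)[OF q] c by simp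
      finally show "r (c *\<^sub>R x) / c \<le> q (x + t *\<^sub>R y) - t * q y"
        using c by (simp add: field_simps)
    qed
    then show "r (c *\<^sub>R x) \<le> c * r x" using c by (simp add: field_simps)
  qed
  moreover have "r \<le> q" using r_le[of 0] by (auto simp: le_fun_def)
  moreover have "r x \<le> q (x + y) - q y" for x using r_le[of 1 x] by simp
  ultimately show ?thesis by blast
qed

text \<open>Zorn for the reversed order. A chain has its pointwise infimum as lower bound, finite
  because all members stay above - q (- x).\<close>

lemma sublinear_minimal_exists:
  fixes q :: "'a::real_vector \<Rightarrow> real"
  assumes q: "sublinear q"
  shows "\<exists>m. sublinear m \<and> m \<le> q \<and> (\<forall>r. sublinear r \<and> r \<le> m \<longrightarrow> r = m)"
proof -
  define A where "A = {r. sublinear r \<and> r \<le> q}"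
  have "\<exists>m\<in>A. \<forall>r\<in>A. r \<le> m \<longrightarrow> r = m"
  proof (rule predicate_Zorn)
    show "partial_order_on A (relation_of (\<lambda>r s. s \<le> r) A)"
      by (rule partial_order_on_relation_ofI) auto
    fix C assume C: "C \<in> Chains (relation_of (\<lambda>r s. s \<le> r) A)"
    then have CA: "C \<subseteq> A" by (rule Chains_relation_of)
    have total: "r \<le> s \<or> s \<le> r" if "r \<in> C" "s \<in> C" for r s
      using C that unfolding Chains_def relation_of_def by blast
    show "\<exists>u\<in>A. \<forall>a\<in>C. u \<le> a"
    proof (cases "C = {}")
      case True
      then show ?thesis using q by (auto simp: A_def)
    next
      case ne: False
      define u where "u x = (INF r\<in>C. r x)" for x
      have sub: "sublinear r" "r \<le> q" if "r \<in> C" for r using that CA by (auto simp: A_def)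
      have lower: "- q (- x) \<le> r x" if "r \<in> C" for r x
        using sublinearD(4)[OF sub(1)[OF that], of x] le_funD[OF sub(2)[OF that], of "- x"] by linarith
      have u_le: "u x \<le> r x" if "r \<in> C" for r x
        unfolding u_def using that lower by (intro cINF_lower) (auto intro!: bdd_belowI2)
      have u_ge: "s \<le> u x" if "\<And>r. r \<in> C \<Longrightarrow> s \<le> r x" for s x
        unfolding u_def using that by (intro cINF_greatest ne)
      have "sublinear u"
      proof (rule sublinearI)
        fix x y
        \<comment> \<open>The infima at x and y are taken separately; the chain provides one member
          below both \<open>r\<close> and \<open>s\<close>.\<close>
        have *: "u (x + y) \<le> r x + s y" if rs: "r \<in> C" "s \<in> C" for r s
        proof -
          obtain t where t: "t \<in> C" "t \<le> r" "t \<le> s" using total[OF rs] rs by blast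
          have "u (x + y) \<le> t x + t y"
            using u_le[OF t(1)] sublinearD(1)[OF sub(1)[OF t(1)], of x y] by (meson order_trans)
          then show ?thesis using le_funD[OF t(2), of x] le_funD[OF t(3), of y] by linarith
        qed
        have "u (x + y) - r x \<le> u y" if "r \<in> C" for r
          using *[OF that] by (intro u_ge) (simp add: algebra_simps)
        then have "u (x + y) - u y \<le> u x"
          by (intro u_ge) (force simp: algebra_simps)
        then show "u (x + y) \<le> u x + u y" by simp
      next
        fix c :: real and x assume c: "0 < c"
        have "u (c *\<^sub>R x) / c \<le> u x"
        proof (rule u_ge)
          fix r assume r: "r \<in> C"
          show "u (c *\<^sub>R x) / c \<le> r x"
            using u_le[OF r, of "c *\<^sub>R x"] sublinearD(2)[OF sub(1)[OF r], of c x] c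
            by (simp add: field_simps)
        qed
        then show "u (c *\<^sub>R x) \<le> c * u x" using c by (simp add: field_simps)
      qed
      moreover have "u \<le> q"
      proof -
        obtain r where "r \<in> C" using ne by blast
        then have "u x \<le> q x" for x
          using u_le[of r x] le_funD[OF sub(2)[of r], of x] by simp
        then show ?thesis by (rule le_funI)
      qed
      ultimately show ?thesis using u_le by (intro bexI[of _ u]) (auto simp: A_def le_fun_def)
    qed
  qed
  then obtain m where "m \<in> A" and m: "\<And>r. r \<in> A \<Longrightarrow> r \<le> m \<Longrightarrow> r = m" by blast
  then show ?thesis unfolding A_def by (intro exI[of _ m]) (auto intro: order_trans)
qed

text \<open>A minimal sublinear functional is linear, and the descent at \<open>x\<^sub>0\<close> already forces equality there.\<close>

lemma hahn_banach_seminorm: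
  fixes p :: "'a::real_vector \<Rightarrow> real"
  assumes add: "\<And>x y. p (x + y) \<le> p x + p y" and scale: "\<And>c x. p (c *\<^sub>R x) = \<bar>c\<bar> * p x"
  shows "\<exists>\<phi>. linear \<phi> \<and> \<phi> x0 = p x0 \<and> (\<forall>x. \<bar>\<phi> x\<bar> \<le> p x)"
proof -
  have p: "sublinear p" using add scale by (simp add: sublinear_def)
  obtain q where q: "sublinear q" "q \<le> p" "\<And>x. q x \<le> p (x + x0) - p x0"
    using sublinear_descent[OF p] by blast
  obtain m where m: "sublinear m" "m \<le> q" and min: "\<And>r. sublinear r \<Longrightarrow> r \<le> m \<Longrightarrow> r = m"
    using sublinear_minimal_exists[OF q(1)] by blast
  have m_add: "m (x + y) = m x + m y" for x y
  proof -
    \<comment> \<open>The descent of \<open>m\<close> along \<open>y\<close> must return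
      \<open>m\<close> itself, which makes \<open>m\<close> superadditive.\<close>
    obtain r where r: "sublinear r" "r \<le> m" "\<And>x. r x \<le> m (x + y) - m y"
      using sublinear_descent[OF m(1)] by blast
    then have "m x \<le> m (x + y) - m y" using min[of r] by metis
    then show ?thesis using sublinearD(1)[OF m(1), of x y] by simp
  qed
  have m_neg: "m (- x) = - m x" for x
    using m_add[of x "- x"] sublinearD(3)[OF m(1)] by simp
  have m_scale: "m (c *\<^sub>R x) = c * m x" for c x
  proof (cases "0 \<le> c")
    case False
    then show ?thesis using sublinearD(2)[OF m(1), of "- c" x] m_neg[of "c *\<^sub>R x"] by simp
  qed (simp add: sublinearD(2)[OF m(1)])
  have m_le: "m x \<le> p x" for x using le_funD[OF m(2), of x] le_funD[OF q(2), of x] by simp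
  have p_neg: "p (- x) = p x" for x using scale[of "- 1" x] by simp
  have "linear m" by (rule linearI) (simp_all add: m_add m_scale)
  moreover have "m x0 = p x0"
  proof (rule antisym[OF m_le])
    \<comment> \<open>At - x0 the descent bound collapses to - p x0.\<close>
    have "m (- x0) \<le> p (- x0 + x0) - p x0"
      using le_funD[OF m(2), of "- x0"] q(3)[of "- x0"] by simp
    then show "p x0 \<le> m x0" using scale[of 0 0] by (simp add: m_neg)
  qed
  moreover have "\<bar>m x\<bar> \<le> p x" for x using m_le[of x] m_le[of "- x"] by (simp add: m_neg p_neg)
  ultimately show ?thesis by blast
qed

section \<open>Distance to a subspace as the quotient seminorm\<close>

lemma infdist_less_attained:
  assumes "E \<noteq> {}" "infdist x E < r"
  shows "\<exists>a\<in>E. dist x a < r"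
  using assms cINF_less_iff[of E "dist x" r] by (auto simp: infdist_notempty intro!: bdd_belowI2)

lemma infdist_subspace_add:
  fixes E :: "'a::real_normed_vector set"
  assumes E: "subspace E"
  shows "infdist (x + y) E \<le> infdist x E + infdist y E"
proof (rule field_le_epsilon)
  fix e :: real assume e: "0 < e"
  have ne: "E \<noteq> {}" using subspace_0[OF E] by blast
  obtain a b where ab: "a \<in> E" "dist x a < infdist x E + e / 2" "b \<in> E" "dist y b < infdist y E + e / 2"
    using infdist_less_attained[OF ne, of x "infdist x E + e / 2"]
      infdist_less_attained[OF ne, of y "infdist y E + e / 2"] e by auto
  have "infdist (x + y) E \<le> dist (x + y) (a + b)"
    using ab E by (intro infdist_le subspace_add) auto
  also have "\<dots> \<le> dist x a + dist y b" by (rule dist_triangle_add)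
  finally show "infdist (x + y) E \<le> infdist x E + infdist y E + e" using ab by simp
qed

lemma infdist_subspace_scaleR:
  fixes E :: "'a::real_normed_vector set"
  assumes E: "subspace E"
  shows "infdist (c *\<^sub>R x) E = \<bar>c\<bar> * infdist x E"
proof -
  have ne: "E \<noteq> {}" using subspace_0[OF E] by blast
  have le: "infdist (d *\<^sub>R y) E \<le> \<bar>d\<bar> * infdist y E" if "d \<noteq> 0" for d y
  proof -
    have "infdist (d *\<^sub>R y) E / \<bar>d\<bar> \<le> dist y a" if a: "a \<in> E" for a
    proof -
      have "infdist (d *\<^sub>R y) E \<le> dist (d *\<^sub>R y) (d *\<^sub>R a)"
        using a E by (intro infdist_le subspace_scale)
      then show ?thesis
        unfolding dist_norm scaleR_right_diff_distrib[symmetric] norm_scaleR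
        using \<open>d \<noteq> 0\<close> by (simp add: divide_le_eq mult.commute)
    qed
    then have "infdist (d *\<^sub>R y) E / \<bar>d\<bar> \<le> infdist y E"
      unfolding infdist_notempty[OF ne, of y] by (intro cINF_greatest ne)
    then show ?thesis using \<open>d \<noteq> 0\<close> by (simp add: field_simps)
  qed
  show ?thesis
  proof (cases "c = 0")
    case True
    then show ?thesis using subspace_0[OF E] by simp
  next
    case False
    then have "infdist (inverse c *\<^sub>R (c *\<^sub>R x)) E \<le> \<bar>inverse c\<bar> * infdist (c *\<^sub>R x) E"
      by (intro le) simp
    then have "\<bar>c\<bar> * infdist x E \<le> infdist (c *\<^sub>R x) E"
      using False by (simp add: field_simps)
    then show ?thesis using le[OF False, of x] by simp
  qed
qed

lemma infdist_le_norm_subspace: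
  fixes E :: "'a::real_normed_vector set"
  shows "subspace E \<Longrightarrow> infdist x E \<le> norm x"
  using infdist_le[OF subspace_0, of E x] by simp

text \<open>The quotient map by \<open>E\<close>, followed by an isometric embedding of the quotient.\<close>

lemma quotient_into_linf:
  fixes E :: "'a::banach_lattice set"
  assumes E: "subspace E"
  shows "\<exists>T :: 'a \<Rightarrow>\<^sub>L 'a linf. \<forall>g. norm (blinfun_apply T g) = infdist g E"
proof -
  have "\<exists>\<phi>. linear \<phi> \<and> \<phi> f = infdist f E \<and> (\<forall>x. \<bar>\<phi> x\<bar> \<le> infdist x E)" for f :: 'a
    by (rule hahn_banach_seminorm[OF infdist_subspace_add[OF E] infdist_subspace_scaleR[OF E]])
  then obtain \<phi> :: "'a \<Rightarrow> 'a \<Rightarrow> real" where lin: "\<And>f. linear (\<phi> f)"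
    and attain: "\<And>f. \<phi> f f = infdist f E" and bound: "\<And>f x. \<bar>\<phi> f x\<bar> \<le> infdist x E"
    by metis
  \<comment> \<open>The coordinate with index f norms f, so the supremum norm of \<open>T g\<close>
    is attained at index g.\<close>
  define T :: "'a \<Rightarrow> 'a linf" where "T g = Bcontfun (\<lambda>d. \<phi> (of_discrete d) g)" for g
  have T: "apply_bcontfun (T g) d = \<phi> (of_discrete d) g" for g d
  proof -
    have "(\<lambda>d. \<phi> (of_discrete d) g) \<in> bcontfun"
    proof (rule bcontfun_normI[where b = "infdist g E"])
      show "continuous_on UNIV (\<lambda>d. \<phi> (of_discrete d) g)"
        by (simp add: continuous_on_open_vimage open_discrete)
    qed (simp add: bound)
    then show ?thesis by (simp add: T_def Bcontfun_inverse)
  qed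
  have norm_T: "norm (T g) = infdist g E" for g
  proof (rule antisym)
    show "norm (T g) \<le> infdist g E" by (rule norm_bound) (simp add: T bound)
    show "infdist g E \<le> norm (T g)"
      using norm_bounded[of "T g" "discrete g"] by (simp add: T attain discrete_inverse infdist_nonneg)
  qed
  have "bounded_linear T"
  proof (rule bounded_linear_intro[where K = 1])
    show "T (x + y) = T x + T y" for x y
      by (rule bcontfun_eqI) (simp add: T linear_add[OF lin])
    show "T (c *\<^sub>R x) = c *\<^sub>R T x" for c x
      by (rule bcontfun_eqI) (simp add: T linear_scale[OF lin])
    show "norm (T x) \<le> norm x * 1" for x
      using infdist_le_norm_subspace[OF E, of x] by (simp add: norm_T)
  qed
  then show ?thesis
    by (intro exI[of _ "Blinfun T"]) (simp add: bounded_linear_Blinfun_apply norm_T)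
qed

section \<open>The aw-topology\<close>

lemma aw_null_mono: "aw_null G \<Longrightarrow> H \<le> G \<Longrightarrow> aw_null H"
  unfolding aw_null_def by (metis tendsto_mono)

lemma norm_null_imp_aw_null:
  assumes "(id \<longlongrightarrow> 0) G"
  shows "aw_null G"
  unfolding aw_null_def
proof
  fix \<nu> :: "'a \<Rightarrow>\<^sub>L real"
  have "((\<lambda>f. norm \<nu> * norm f) \<longlongrightarrow> norm \<nu> * 0) G"
    using tendsto_norm_zero[OF assms] by (intro tendsto_mult tendsto_const) simp
  moreover have "norm (blinfun_apply \<nu> (labs f)) \<le> norm \<nu> * norm f" for f
    using norm_blinfun[of \<nu> "labs f"] by simp
  ultimately show "((\<lambda>f. blinfun_apply \<nu> (labs f)) \<longlongrightarrow> 0) G"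
    by - (rule Lim_null_comparison[where g = "\<lambda>f. norm \<nu> * norm f"], simp_all)
qed

text \<open>Taking moduli is a contraction, so a norm-null perturbation changes \<nu> (|f|) by a
  null amount.\<close>

lemma aw_null_filtermap_close:
  assumes G: "aw_null G" and lim: "((\<lambda>f. norm (e f - f)) \<longlongrightarrow> 0) G"
  shows "aw_null (filtermap e G)"
  unfolding aw_null_def filterlim_filtermap
proof
  fix \<nu> :: "'a \<Rightarrow>\<^sub>L real"
  have "((\<lambda>f. norm \<nu> * norm (e f - f)) \<longlongrightarrow> norm \<nu> * 0) G"
    by (intro tendsto_mult tendsto_const lim)
  moreover have "norm (blinfun_apply \<nu> (labs (e f) - labs f)) \<le> norm \<nu> * norm (e f - f)" for f
    using norm_blinfun[of \<nu> "labs (e f) - labs f"] mult_left_mono[OF norm_labs_diff[of "e f" f], of "norm \<nu>"]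
    by simp
  ultimately have "((\<lambda>f. blinfun_apply \<nu> (labs (e f) - labs f)) \<longlongrightarrow> 0) G"
    by - (rule Lim_null_comparison[where g = "\<lambda>f. norm \<nu> * norm (e f - f)"], simp_all)
  moreover have "((\<lambda>f. blinfun_apply \<nu> (labs f)) \<longlongrightarrow> 0) G" using G by (simp add: aw_null_def)
  ultimately have "((\<lambda>f. blinfun_apply \<nu> (labs (e f) - labs f) + blinfun_apply \<nu> (labs f)) \<longlongrightarrow> 0 + 0) G"
    by (rule tendsto_add)
  then show "((\<lambda>f. blinfun_apply \<nu> (labs (e f))) \<longlongrightarrow> 0) G"
    by (simp add: blinfun.diff_right)
qed

section \<open>Order continuity, the aaw-topology and exhaustiveness\<close>

lemma boundedly_exhaustive_iff:
  "aw_boundedly_exhaustive TYPE('a::banach_lattice) \<longleftrightarrow>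
    (\<forall>(x :: nat \<Rightarrow> 'a) \<nu> :: 'a \<Rightarrow>\<^sub>L real. bounded (range x) \<longrightarrow> disjoint_seq x
      \<longrightarrow> (\<lambda>n. blinfun_apply \<nu> (labs (x n))) \<longlonglongrightarrow> 0)"
  unfolding aw_boundedly_exhaustive_def aw_null_def filterlim_filtermap by blast

lemma dual_order_continuous_imp_aw_eq_aaw:
  assumes "dual_order_continuous TYPE('a::banach_lattice)"
  shows "aw_eq_aaw TYPE('a)"
proof -
  have lim: "((\<lambda>\<mu>. norm \<mu>) \<longlongrightarrow> 0) (down_net D)" if "down_directed D" "dinf_zero D"
    for D :: "('a \<Rightarrow>\<^sub>L real) set"
    using assms that unfolding dual_order_continuous_def by simp
  have "\<nu> \<in> dual_oc_part" for \<nu> :: "'a \<Rightarrow>\<^sub>L real"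
    unfolding dual_oc_part_def by (intro CollectI allI impI lim) (elim conjE, assumption)+
  then show ?thesis by (simp add: aw_eq_aaw_def aw_null_def aaw_null_def Ball_def)
qed

lemma aw_eq_aaw_imp_boundedly_exhaustive:
  assumes "aw_eq_aaw TYPE('a::banach_lattice)"
  shows "aw_boundedly_exhaustive TYPE('a)"
  unfolding aw_boundedly_exhaustive_def
proof (intro allI impI)
  fix x :: "nat \<Rightarrow> 'a" assume "bounded (range x) \<and> disjoint_seq x"
  then have "aaw_null (filtermap x sequentially)"
    by (simp add: aaw_null_def filterlim_filtermap dual_oc_part_disjoint_null)
  then show "aw_null (filtermap x sequentially)"
    using assms by (simp add: aw_eq_aaw_def)
qed

text \<open>The iterated limit: it inherits every limit common to all \<open>F k\<close>, as well as
  bounds that only improve with k.\<close>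

lemma iterated_filter_exists:
  fixes F :: "nat \<Rightarrow> 'a filter"
  shows "\<exists>G. \<forall>P. eventually P G \<longleftrightarrow> (\<forall>\<^sub>F k in sequentially. eventually P (F k))"
proof (intro exI allI)
  fix P
  have "is_filter (\<lambda>P. \<forall>\<^sub>F k in sequentially. eventually P (F k))"
  proof (rule is_filter.intro)
    fix P Q
    assume "\<forall>\<^sub>F k in sequentially. eventually P (F k)" "\<forall>\<^sub>F k in sequentially. eventually Q (F k)"
    then show "\<forall>\<^sub>F k in sequentially. eventually (\<lambda>x. P x \<and> Q x) (F k)"
      by eventually_elim (rule eventually_conj)
  next
    fix P Q
    assume "\<forall>x. P x \<longrightarrow> Q x" "\<forall>\<^sub>F k in sequentially. eventually P (F k)"
    then show "\<forall>\<^sub>F k in sequentially. eventually Q (F k)"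
      by (auto elim!: eventually_mono)
  qed simp
  then show "eventually P (Abs_filter (\<lambda>P. \<forall>\<^sub>F k in sequentially. eventually P (F k))) \<longleftrightarrow>
      (\<forall>\<^sub>F k in sequentially. eventually P (F k))"
    by (rule eventually_Abs_filter)
qed

text \<open>If \<open>T\<close> is not \<open>\<infinity>\<close>-DNS, disjoint sequences with ever smaller \<open>\<parallel>T f\<parallel>\<close> combine into one
  iterated aw-null filter on the sphere along which \<open>\<parallel>T f\<parallel>\<close> tends to \<open>0\<close>.\<close>

lemma complements_aw_imp_inf_DNS:
  fixes T :: "'a::banach_lattice \<Rightarrow>\<^sub>L 'b::banach"
  assumes exh: "aw_boundedly_exhaustive TYPE('a)" and T: "complements_aw T"
  shows "inf_DNS T"
proof (rule ccontr)
  assume "\<not> inf_DNS T"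
  then have "\<forall>r>0. \<exists>x. disjoint_seq x \<and> (\<forall>n. norm (x n) = 1) \<and>
      liminf (\<lambda>n. ereal (norm (blinfun_apply T (x n)))) \<le> ereal r"
    unfolding inf_DNS_def by (meson not_le)
  then have "\<forall>k. \<exists>x. disjoint_seq x \<and> (\<forall>n. norm (x n) = 1) \<and>
      liminf (\<lambda>n. ereal (norm (blinfun_apply T (x n)))) \<le> ereal (inverse (real (Suc k)))"
    by simp
  then obtain X where X: "\<And>k. disjoint_seq (X k)" "\<And>k n. norm (X k n) = 1"
    "\<And>k. liminf (\<lambda>n. ereal (norm (blinfun_apply T (X k n)))) \<le> ereal (inverse (real (Suc k)))"
    by metis
  \<comment> \<open>A liminf of at most 1/(k+1) need not be undercut by any term; the doubled bound
    is undercut infinitely often.\<close>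
  define N where "N k = {n. norm (blinfun_apply T (X k n)) < 2 * inverse (real (Suc k))}" for k
  \<comment> \<open>Intersecting with \<open>principal (N k)\<close> acts as passing to a
    subsequence.\<close>
  define F where "F k = filtermap (X k) (inf sequentially (principal (N k)))" for k
  have nonbot: "F k \<noteq> bot" for k
  proof
    assume "F k = bot"
    then have "\<forall>\<^sub>F n in sequentially. n \<notin> N k"
      by (simp add: F_def trivial_limit_def eventually_filtermap eventually_inf_principal)
    then have "\<forall>\<^sub>F n in sequentially. ereal (2 * inverse (real (Suc k))) \<le> ereal (norm (blinfun_apply T (X k n)))"
      by (simp add: N_def not_less)
    then have "ereal (2 * inverse (real (Suc k))) \<le> liminf (\<lambda>n. ereal (norm (blinfun_apply T (X k n))))"
      by (rule Liminf_bounded)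
    then have "2 * inverse (real (Suc k)) \<le> inverse (real (Suc k))"
      using X(3)[of k] by (metis ereal_less_eq(3) order_trans)
    then show False by (simp add: field_simps)
  qed
  have F_aw: "aw_null (F k)" for k
  proof (rule aw_null_mono)
    have "bounded (range (X k))" by (auto simp: bounded_iff X(2) intro!: exI[of _ 1])
    then show "aw_null (filtermap (X k) sequentially)"
      using exh X(1) by (simp add: aw_boundedly_exhaustive_def)
    show "F k \<le> filtermap (X k) sequentially" by (simp add: F_def filtermap_mono)
  qed
  have F_N: "\<forall>\<^sub>F f in F k. norm f = 1 \<and> norm (blinfun_apply T f) < 2 * inverse (real (Suc k))" for k
    by (simp add: F_def eventually_filtermap eventually_inf_principal X(2) N_def)
  obtain G where G: "\<And>P. eventually P G \<longleftrightarrow> (\<forall>\<^sub>F k in sequentially. eventually P (F k))"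
    using iterated_filter_exists[of F] by blast
  have "G \<noteq> bot"
    using nonbot by (simp add: trivial_limit_def G)
  moreover have "\<forall>\<^sub>F f in G. norm f = 1"
    unfolding G by (intro always_eventually allI eventually_mono[OF F_N]) simp
  moreover have "aw_null G"
    unfolding aw_null_def
  proof (intro allI tendstoI)
    fix \<nu> :: "'a \<Rightarrow>\<^sub>L real" and e :: real assume "0 < e"
    then have "\<forall>\<^sub>F f in F k. dist (blinfun_apply \<nu> (labs f)) 0 < e" for k
      using F_aw[of k] tendstoD unfolding aw_null_def by fast
    then show "\<forall>\<^sub>F f in G. dist (blinfun_apply \<nu> (labs f)) 0 < e" by (simp add: G)
  qed
  moreover have "((\<lambda>f. norm (blinfun_apply T f)) \<longlongrightarrow> 0) G"
  proof (rule tendstoI)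
    fix e :: real assume e: "0 < e"
    have "(\<lambda>k. 2 * inverse (real (Suc k))) \<longlonglongrightarrow> 2 * 0"
      by (intro tendsto_intros LIMSEQ_inverse_real_of_nat)
    then have "\<forall>\<^sub>F k in sequentially. 2 * inverse (real (Suc k)) < e"
      using e by (intro order_tendstoD) simp_all
    then show "\<forall>\<^sub>F f in G. dist (norm (blinfun_apply T f)) 0 < e"
      unfolding G
    proof eventually_elim
      case (elim k)
      from F_N[of k] show ?case by eventually_elim (use elim in simp)
    qed
  qed
  ultimately show False using T unfolding complements_aw_def by blast
qed

lemma liminf_null_sequence_not_greater:
  assumes "X \<longlonglongrightarrow> (0::real)" "0 < r"
  shows "\<not> liminf (\<lambda>n. ereal (X n)) > ereal r"
proof -
  have "(\<lambda>n. ereal (X n)) \<longlonglongrightarrow> ereal 0" using assms(1) by (simp add: lim_ereal)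
  then have "liminf (\<lambda>n. ereal (X n)) = ereal 0" by (intro lim_imp_Liminf) simp_all
  then show ?thesis using assms(2) by simp
qed

lemma inf_DNS_imp_DNS: "inf_DNS T \<Longrightarrow> DNS T"
  unfolding inf_DNS_def DNS_def using liminf_null_sequence_not_greater by blast

text \<open>Vectors whose distance to \<open>E\<close> tends to 0 can be moved into \<open>E\<close>
  by a norm-null change. They remain aw-null, hence become norm-null, against norm 1.\<close>

lemma agrees_imp_quotient_complements:
  fixes T :: "'a::banach_lattice \<Rightarrow>\<^sub>L 'b::banach"
  assumes E: "closed_subspace E" and agrees: "aw_agrees_norm_on E"
    and T: "\<And>g. norm (blinfun_apply T g) = infdist g E"
  shows "complements_aw T"
  unfolding complements_aw_def
proof
  assume "\<exists>G. G \<noteq> bot \<and> (\<forall>\<^sub>F f in G. norm f = 1) \<and> aw_null G \<and> ((\<lambda>f. norm (blinfun_apply T f)) \<longlongrightarrow> 0) G"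
  then obtain G where G: "G \<noteq> bot" "\<forall>\<^sub>F f in G. norm f = 1" "aw_null G"
    and lim: "((\<lambda>f. infdist f E) \<longlongrightarrow> 0) G"
    by (auto simp: T)
  have sub: "subspace E" and cl: "closed E" using E by (simp_all add: closed_subspace_def)
  have ne: "E \<noteq> {}" using subspace_0[OF sub] by blast
  \<comment> \<open>The distance need not be attained, hence the factor 2; at distance 0 closedness
    puts f itself in \<open>E\<close>.\<close>
  have "\<exists>a\<in>E. norm (a - f) \<le> 2 * infdist f E" for f
  proof (cases "infdist f E = 0")
    case True
    then have "f \<in> E" using in_closed_iff_infdist_zero[OF cl ne] by blast
    then show ?thesis by (intro bexI[of _ f]) (simp_all add: infdist_nonneg)
  next
    case False
    then have "infdist f E < 2 * infdist f E" using infdist_nonneg[of f E] by simp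
    from infdist_less_attained[OF ne this] show ?thesis
      by (auto simp: dist_norm norm_minus_commute intro: less_imp_le)
  qed
  then obtain a where a: "\<And>f. a f \<in> E" "\<And>f. norm (a f - f) \<le> 2 * infdist f E" by metis
  have "((\<lambda>f. 2 * infdist f E) \<longlongrightarrow> 2 * 0) G" by (intro tendsto_intros lim)
  then have close: "((\<lambda>f. a f - f) \<longlongrightarrow> 0) G"
    by - (rule Lim_null_comparison[where g = "\<lambda>f. 2 * infdist f E"], simp_all add: a)
  have "filtermap a G \<le> principal E"
    by (simp add: le_principal eventually_filtermap a)
  moreover have "aw_null (filtermap a G)"
    by (rule aw_null_filtermap_close[OF G(3) tendsto_norm_zero[OF close]])
  ultimately have "(id \<longlongrightarrow> 0) (filtermap a G)"
    using agrees unfolding aw_agrees_norm_on_def by blast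
  then have "(a \<longlongrightarrow> 0) G" by (simp add: filterlim_filtermap)
  from tendsto_diff[OF this close] have "((\<lambda>f. f) \<longlongrightarrow> 0) G" by simp
  then have "((\<lambda>f. norm f) \<longlongrightarrow> 0) G" by (rule tendsto_norm_zero)
  then have "\<forall>\<^sub>F f in G. norm f < 1" by (rule order_tendstoD) simp
  with G(2) have "\<forall>\<^sub>F f in G. False" by eventually_elim simp
  then show False using G(1) by (simp add: trivial_limit_def)
qed

text \<open>Disjoint vectors that approach the sphere of \<open>E\<close> have norms tending to 1,
  so normalizing a tail keeps their distance to \<open>E\<close> null.\<close>

lemma inf_dispersed_imp_dispersed:
  fixes E :: "'a::banach_lattice set"
  assumes sub: "subspace E" and disp: "inf_dispersed E"
  shows "dispersed E"
  unfolding dispersed_def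
proof
  assume "\<exists>e f. (\<forall>n. e n \<in> E \<and> norm (e n) = 1) \<and> disjoint_seq f \<and> (\<lambda>n. norm (e n - f n)) \<longlonglongrightarrow> 0"
  then obtain e f where e: "\<And>n. e n \<in> E" "\<And>n. norm (e n) = 1" and f: "disjoint_seq f"
    and lim: "(\<lambda>n. norm (e n - f n)) \<longlonglongrightarrow> 0" by blast
  have "(\<lambda>n. norm (e n - (e n - f n))) \<longlonglongrightarrow> 1"
  proof (rule tendsto_sandwich[OF always_eventually always_eventually])
    show "\<forall>n. 1 - norm (e n - f n) \<le> norm (e n - (e n - f n))"
      using norm_triangle_ineq2[of "e _" "e _ - f _"] e(2) by metis
    show "\<forall>n. norm (e n - (e n - f n)) \<le> 1 + norm (e n - f n)"
      using norm_triangle_ineq4[of "e _" "e _ - f _"] e(2) by metis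
    show "(\<lambda>n. 1 - norm (e n - f n)) \<longlonglongrightarrow> 1" using tendsto_diff[OF tendsto_const lim, of 1] by simp
    show "(\<lambda>n. 1 + norm (e n - f n)) \<longlonglongrightarrow> 1" using tendsto_add[OF tendsto_const lim, of 1] by simp
  qed
  then have f1: "(\<lambda>n. norm (f n)) \<longlonglongrightarrow> 1" by simp
  then have "\<forall>\<^sub>F n in sequentially. 0 < norm (f n)" by (rule order_tendstoD) simp
  then obtain N where N: "\<And>n. N \<le> n \<Longrightarrow> f n \<noteq> 0" by (auto simp: eventually_sequentially)
  define g where "g n = inverse (norm (f (n + N))) *\<^sub>R f (n + N)" for n
  have "disjoint_seq g"
    unfolding g_def by (intro disjoint_seq_scaleR disjoint_seq_comp[OF f]) simp
  moreover have "\<forall>n. norm (g n) = 1" using N by (simp add: g_def)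
  moreover have "(\<lambda>n. infdist (g n) E) \<longlonglongrightarrow> 0"
  proof (rule Lim_null_comparison)
    show "\<forall>\<^sub>F n in sequentially. norm (infdist (g n) E) \<le> norm (e (n + N) - f (n + N)) / norm (f (n + N))"
    proof (intro always_eventually allI)
      fix n
      have "infdist (g n) E = infdist (f (n + N)) E / norm (f (n + N))"
        by (simp add: g_def infdist_subspace_scaleR[OF sub] divide_inverse mult.commute)
      also have "infdist (f (n + N)) E \<le> norm (e (n + N) - f (n + N))"
        using infdist_le[OF e(1), of "f (n + N)" "n + N"] by (simp add: dist_norm norm_minus_commute)
      finally show "norm (infdist (g n) E) \<le> norm (e (n + N) - f (n + N)) / norm (f (n + N))"
        by (simp add: infdist_nonneg divide_right_mono)
    qed
    have "(\<lambda>n. norm (e n - f n) / norm (f n)) \<longlonglongrightarrow> 0 / 1"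
      by (intro tendsto_divide lim f1) simp
    from LIMSEQ_ignore_initial_segment[OF this, of N]
    show "(\<lambda>n. norm (e (n + N) - f (n + N)) / norm (f (n + N))) \<longlonglongrightarrow> 0" by simp
  qed
  ultimately show False
    using disp liminf_null_sequence_not_greater unfolding inf_dispersed_def by blast
qed

section \<open>Closed spans of disjoint sequences\<close>

lemma normalized_disjoint_seq:
  assumes "disjoint_seq x" "\<And>n. x n \<noteq> 0"
  shows "disjoint_seq (\<lambda>n. inverse (norm (x n)) *\<^sub>R x n)"
    "norm (inverse (norm (x n)) *\<^sub>R x n) = 1"
    "inverse (norm (x n)) *\<^sub>R x n \<in> closure (span (range x))"
proof -
  show "disjoint_seq (\<lambda>n. inverse (norm (x n)) *\<^sub>R x n)"
    by (rule disjoint_seq_scaleR[OF assms(1)])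
  show "norm (inverse (norm (x n)) *\<^sub>R x n) = 1"
    using assms(2) by simp
  have "inverse (norm (x n)) *\<^sub>R x n \<in> span (range x)"
    by (intro span_scale span_base rangeI)
  then show "inverse (norm (x n)) *\<^sub>R x n \<in> closure (span (range x))"
    by (rule closure_subset[THEN subsetD])
qed

lemma subspace_closure:
  fixes S :: "'a::real_normed_vector set"
  assumes S: "subspace S"
  shows "subspace (closure S)"
proof (rule subspaceI)
  show "0 \<in> closure S" using subspace_0[OF S] closure_subset by blast
next
  fix x y assume "x \<in> closure S" "y \<in> closure S"
  then obtain X Y where "\<And>n. X n \<in> S" "X \<longlonglongrightarrow> x" "\<And>n. Y n \<in> S" "Y \<longlonglongrightarrow> y"
    unfolding closure_sequential by blast
  then have "\<forall>n. X n + Y n \<in> S" "(\<lambda>n. X n + Y n) \<longlonglongrightarrow> x + y"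
    by (auto intro: subspace_add[OF S] tendsto_add)
  then show "x + y \<in> closure S"
    unfolding closure_sequential by (intro exI[of _ "\<lambda>n. X n + Y n"] conjI)
next
  fix c :: real and x assume "x \<in> closure S"
  then obtain X where "\<And>n. X n \<in> S" "X \<longlonglongrightarrow> x"
    unfolding closure_sequential by blast
  then have "\<forall>n. c *\<^sub>R X n \<in> S" "(\<lambda>n. c *\<^sub>R X n) \<longlonglongrightarrow> c *\<^sub>R x"
    by (auto intro: subspace_scale[OF S] tendsto_scaleR)
  then show "c *\<^sub>R x \<in> closure S"
    unfolding closure_sequential by (intro exI[of _ "\<lambda>n. c *\<^sub>R X n"] conjI)
qed

lemma closed_subspace_closure_span: "closed_subspace (closure (span S))"
  by (simp add: closed_subspace_def subspace_closure)

text \<open>A bounded disjoint sequence on which \<open>\<nu>\<close> stays away from \<open>0\<close> spans a copy of \<open>\<ell>\<^sub>1\<close>, and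
  there \<open>\<nu> |f|\<close> dominates a multiple of \<open>\<parallel>f\<parallel>\<close>.\<close>

lemma not_boundedly_exhaustive_imp_agrees:
  assumes "\<not> aw_boundedly_exhaustive TYPE('a::banach_lattice)"
  shows "\<exists>x::nat \<Rightarrow> 'a. disjoint_seq x \<and> (\<forall>n. x n \<noteq> 0) \<and> aw_agrees_norm_on (closure (span (range x)))"
proof -
  obtain x :: "nat \<Rightarrow> 'a" and \<nu>0 :: "'a \<Rightarrow>\<^sub>L real" where x: "bounded (range x)" "disjoint_seq x"
    and nolim: "\<not> (\<lambda>n. blinfun_apply \<nu>0 (labs (x n))) \<longlonglongrightarrow> 0"
    using assms unfolding boundedly_exhaustive_iff by blast
  obtain e where e: "0 < e" and freq: "\<exists>\<^sub>F n in sequentially. e \<le> \<bar>blinfun_apply \<nu>0 (labs (x n))\<bar>"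
    using nolim unfolding tendsto_iff by (auto simp: not_eventually not_less)
  \<comment> \<open>One sign occurs infinitely often; \<nu> is \<open>\<nu>0\<close> or its negative
    accordingly.\<close>
  have "\<exists>\<nu> :: 'a \<Rightarrow>\<^sub>L real. \<exists>\<^sub>F n in sequentially. e \<le> blinfun_apply \<nu> (labs (x n))"
  proof -
    have "\<exists>\<^sub>F n in sequentially. e \<le> blinfun_apply \<nu>0 (labs (x n)) \<or> e \<le> blinfun_apply (- \<nu>0) (labs (x n))"
      using freq by (rule frequently_elim1) (auto simp: blinfun.minus_left abs_if split: if_splits)
    then show ?thesis unfolding frequently_disj_iff by blast
  qed
  then obtain \<nu> :: "'a \<Rightarrow>\<^sub>L real" where "\<exists>\<^sub>F n in sequentially. e \<le> blinfun_apply \<nu> (labs (x n))" by blast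
  then have "infinite {n. e \<le> blinfun_apply \<nu> (labs (x n))}"
    unfolding frequently_cofinite[symmetric] cofinite_eq_sequentially .
  then obtain r :: "nat \<Rightarrow> nat" where r: "strict_mono r" "\<And>n. e \<le> blinfun_apply \<nu> (labs (x (r n)))"
    using infinite_enumerate by blast
  define y where "y n = x (r n)" for n
  have y: "disjoint_seq y"
    unfolding y_def by (rule disjoint_seq_comp[OF x(2) strict_mono_imp_inj_on[OF r(1)]])
  have y\<nu>: "e \<le> blinfun_apply \<nu> (labs (y n))" for n using r(2) by (simp add: y_def)
  have y0: "y n \<noteq> 0" for n using y\<nu>[of n] e by (auto simp: blinfun.zero_right)
  \<comment> \<open>Spans are written as sums over sets of vectors; injectivity reindexes them by
    natural numbers.\<close>
  have inj: "inj y"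
  proof (rule injI, rule ccontr)
    fix m n assume "y m = y n" "m \<noteq> n"
    then have "inf (labs (y n)) (labs (y n)) = 0"
      using y unfolding disjoint_seq_def by metis
    then show False using y0[of n] by simp
  qed
  obtain C where C: "0 < C" "\<And>n. norm (y n) \<le> C"
    using x(1) unfolding bounded_pos y_def by auto
  define E where "E = closure (span (range y))"
  \<comment> \<open>Each term satisfies \<nu> (|y_i|) \<ge> e \<ge> (e/C) times its norm; the
    modulus is additive over disjoint terms and the norm subadditive.\<close>
  have span: "e / C * norm z \<le> blinfun_apply \<nu> (labs z)" if "z \<in> span (range y)" for z
  proof -
    obtain t c where t: "finite t" "t \<subseteq> range y" "z = (\<Sum>a\<in>t. c a *\<^sub>R a)"
      using \<open>z \<in> span (range y)\<close> unfolding span_explicit by blast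
    obtain I where I: "t = y ` I" "finite I"
      using finite_subset_image[OF t(1,2)] by blast
    have z: "z = (\<Sum>i\<in>I. c (y i) *\<^sub>R y i)"
      unfolding t(3) I(1) by (rule sum.reindex_cong[OF inj_on_subset[OF inj]]) simp_all
    have "e / C * norm z \<le> e / C * (\<Sum>i\<in>I. \<bar>c (y i)\<bar> * norm (y i))"
      unfolding z using e C(1) by (intro mult_left_mono order_trans[OF norm_sum]) simp_all
    also have "\<dots> = (\<Sum>i\<in>I. \<bar>c (y i)\<bar> * (e / C * norm (y i)))"
      by (simp add: sum_distrib_left mult.left_commute)
    also have "\<dots> \<le> (\<Sum>i\<in>I. \<bar>c (y i)\<bar> * blinfun_apply \<nu> (labs (y i)))"
    proof (intro sum_mono mult_left_mono)
      fix i
      have "e / C * norm (y i) \<le> e / C * C" using e C by (intro mult_left_mono) auto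
      also have "\<dots> = e" using C by simp
      finally show "e / C * norm (y i) \<le> blinfun_apply \<nu> (labs (y i))" using y\<nu>[of i] by simp
    qed simp
    also have "\<dots> = blinfun_apply \<nu> (labs z)"
      unfolding z labs_sum_disjoint[OF I(2) y] by (simp add: blinfun.sum_right blinfun.scaleR_right)
    finally show ?thesis .
  qed
  have "closed {z. e / C * norm z \<le> blinfun_apply \<nu> (labs z)}"
    by (intro closed_Collect_le continuous_intros)
  then have lower: "e / C * norm z \<le> blinfun_apply \<nu> (labs z)" if "z \<in> E" for z
    using closure_minimal[of "span (range y)" "{z. e / C * norm z \<le> blinfun_apply \<nu> (labs z)}"] span that
    by (auto simp: E_def)
  have "aw_agrees_norm_on E"
    unfolding aw_agrees_norm_on_def
  proof (intro allI impI iffI norm_null_imp_aw_null)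
    fix G :: "'a filter" assume GE: "G \<le> principal E" and "aw_null G"
    then have "((\<lambda>f. blinfun_apply \<nu> (labs f)) \<longlongrightarrow> 0) G" by (simp add: aw_null_def)
    then have "((\<lambda>f. C / e * blinfun_apply \<nu> (labs f)) \<longlongrightarrow> C / e * 0) G" by (intro tendsto_mult tendsto_const)
    moreover have "\<forall>\<^sub>F f in G. f \<in> E" using GE by (simp add: le_principal)
    then have "\<forall>\<^sub>F f in G. norm (id f) \<le> C / e * blinfun_apply \<nu> (labs f)"
    proof eventually_elim
      case (elim f)
      then show ?case using lower[of f] e C by (simp add: field_simps)
    qed
    ultimately show "(id \<longlongrightarrow> 0) G" by - (rule Lim_null_comparison[of id], simp_all)
  qed
  then show ?thesis using y y0 unfolding E_def by blast
qed

text \<open>Types are quantified only outermost. So "for every H" as a conclusion becomes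
  implications with arbitrary \<open>'b\<close> and \<open>'c\<close>, while as a hypothesis it is
  specialized to \<open>'a linf\<close>, which strengthens the converse.\<close>

theorem mainTheorem5:
  fixes TYPE_F :: "'a::banach_lattice itself"
  shows
  "(dual_order_continuous TYPE('a) \<longleftrightarrow> aw_eq_aaw TYPE('a))
   \<and> (dual_order_continuous TYPE('a) \<longleftrightarrow> aw_boundedly_exhaustive TYPE('a))
   \<and> (dual_order_continuous TYPE('a) \<longleftrightarrow>
        (\<forall>T::'a \<Rightarrow>\<^sub>L 'a linf. complements_aw T \<longrightarrow> inf_DNS T))
   \<and> (dual_order_continuous TYPE('a) \<longrightarrow>
        (\<forall>T::'a \<Rightarrow>\<^sub>L 'b::banach. complements_aw T \<longrightarrow> inf_DNS T))
   \<and> (dual_order_continuous TYPE('a) \<longleftrightarrow>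
        (\<forall>T::'a \<Rightarrow>\<^sub>L 'a linf. complements_aw T \<longrightarrow> DNS T))
   \<and> (dual_order_continuous TYPE('a) \<longrightarrow>
        (\<forall>T::'a \<Rightarrow>\<^sub>L 'c::banach. complements_aw T \<longrightarrow> DNS T))
   \<and> (dual_order_continuous TYPE('a) \<longleftrightarrow>
        (\<forall>E::'a set. closed_subspace E \<and> aw_agrees_norm_on E \<longrightarrow> inf_dispersed E))
   \<and> (dual_order_continuous TYPE('a) \<longleftrightarrow>
        (\<forall>E::'a set. closed_subspace E \<and> aw_agrees_norm_on E \<longrightarrow> dispersed E))
   \<and> (dual_order_continuous TYPE('a) \<longleftrightarrow>
        \<not> (\<exists>x::nat \<Rightarrow> 'a. disjoint_seq x \<and> (\<forall>n. x n \<noteq> 0) \<and>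
             aw_agrees_norm_on (closure (span (range x)))))"
proof -
  let ?exh = "aw_boundedly_exhaustive TYPE('a)"
  let ?agree = "\<exists>x::nat \<Rightarrow> 'a. disjoint_seq x \<and> (\<forall>n. x n \<noteq> 0) \<and> aw_agrees_norm_on (closure (span (range x)))"
  \<comment> \<open>Exhaustiveness serves as the hub: every other condition is compared with
    it.\<close>
  have doc_iff: "dual_order_continuous TYPE('a) \<longleftrightarrow> ?exh"
    using dual_order_continuous_imp_aw_eq_aaw aw_eq_aaw_imp_boundedly_exhaustive
      disjoint_null_imp_dual_order_continuous[where 'a = 'a]
    unfolding boundedly_exhaustive_iff by blast
  have ii: "aw_eq_aaw TYPE('a) \<longleftrightarrow> ?exh"
    using dual_order_continuous_imp_aw_eq_aaw aw_eq_aaw_imp_boundedly_exhaustive doc_iff by blast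
  have iv_v: "inf_dispersed E"
    if "\<forall>T::'a \<Rightarrow>\<^sub>L 'a linf. complements_aw T \<longrightarrow> inf_DNS T" "closed_subspace E" "aw_agrees_norm_on E"
    for E :: "'a set"
  proof -
    obtain T :: "'a \<Rightarrow>\<^sub>L 'a linf" where T: "\<And>g. norm (blinfun_apply T g) = infdist g E"
      using quotient_into_linf \<open>closed_subspace E\<close> unfolding closed_subspace_def by blast
    then have "inf_DNS T"
      using that agrees_imp_quotient_complements by blast
    \<comment> \<open>As norms of images under \<open>T\<close> are distances to \<open>E\<close>,
      both notions are the same inequality.\<close>
    then show ?thesis by (simp add: inf_DNS_def inf_dispersed_def T)
  qed
  have iv'_vi: "\<not> ?agree" if DNS: "\<forall>T::'a \<Rightarrow>\<^sub>L 'a linf. complements_aw T \<longrightarrow> DNS T"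
  proof
    assume ?agree
    then obtain x :: "nat \<Rightarrow> 'a" where x: "disjoint_seq x" "\<And>n. x n \<noteq> 0"
      and ag: "aw_agrees_norm_on (closure (span (range x)))" by blast
    let ?E = "closure (span (range x))"
    have E: "closed_subspace ?E" by (rule closed_subspace_closure_span)
    obtain T :: "'a \<Rightarrow>\<^sub>L 'a linf" where T: "\<And>g. norm (blinfun_apply T g) = infdist g ?E"
      using quotient_into_linf E unfolding closed_subspace_def by blast
    have "DNS T" using DNS agrees_imp_quotient_complements[OF E ag T] by blast
    \<comment> \<open>The normalized terms lie in the span itself, so their images vanish.\<close>
    moreover have "(\<lambda>n. norm (blinfun_apply T (inverse (norm (x n)) *\<^sub>R x n))) \<longlonglongrightarrow> 0"
      unfolding T using normalized_disjoint_seq(3)[of x, OF x] by simp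
    ultimately show False
      using normalized_disjoint_seq(1,2)[of x, OF x] unfolding DNS_def by blast
  qed
  have v'_vi: "\<not> ?agree"
    if disp: "\<forall>E::'a set. closed_subspace E \<and> aw_agrees_norm_on E \<longrightarrow> dispersed E"
  proof
    assume ?agree
    then obtain x :: "nat \<Rightarrow> 'a" where x: "disjoint_seq x" "\<And>n. x n \<noteq> 0"
      and "aw_agrees_norm_on (closure (span (range x)))" by blast
    then have d: "dispersed (closure (span (range x)))"
      using disp closed_subspace_closure_span by blast
    define y where "y n = inverse (norm (x n)) *\<^sub>R x n" for n
    have "(\<forall>n. y n \<in> closure (span (range x)) \<and> norm (y n) = 1) \<and> disjoint_seq y \<and> (\<lambda>n. norm (y n - y n)) \<longlonglongrightarrow> 0"
      using normalized_disjoint_seq[of x, OF x] unfolding y_def by simp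
    with d show False unfolding dispersed_def by blast
  qed
  have vi: "?exh" if "\<not> ?agree"
    using that not_boundedly_exhaustive_imp_agrees by blast
  have iv: "inf_DNS T" if "?exh" "complements_aw T" for T :: "'a \<Rightarrow>\<^sub>L 'a linf"
    by (rule complements_aw_imp_inf_DNS[OF that])
  have v: "inf_dispersed E" if "?exh" "closed_subspace E \<and> aw_agrees_norm_on E" for E :: "'a set"
    using that iv by (intro iv_v) simp_all
  have v': "dispersed E" if "inf_dispersed E" "closed_subspace E" for E :: "'a set"
    using that by (intro inf_dispersed_imp_dispersed) (simp_all add: closed_subspace_def)
  show ?thesis
    unfolding doc_iff ii
  proof (intro conjI)
    show "?exh \<longleftrightarrow> (\<forall>T::'a \<Rightarrow>\<^sub>L 'a linf. complements_aw T \<longrightarrow> inf_DNS T)"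
    proof
      show "\<forall>T::'a \<Rightarrow>\<^sub>L 'a linf. complements_aw T \<longrightarrow> inf_DNS T" if "?exh"
        using iv[OF that] by simp
      show "?exh" if "\<forall>T::'a \<Rightarrow>\<^sub>L 'a linf. complements_aw T \<longrightarrow> inf_DNS T"
        by (intro vi iv'_vi allI impI inf_DNS_imp_DNS that[rule_format])
    qed
    show "?exh \<longleftrightarrow> (\<forall>T::'a \<Rightarrow>\<^sub>L 'a linf. complements_aw T \<longrightarrow> DNS T)"
    proof
      show "\<forall>T::'a \<Rightarrow>\<^sub>L 'a linf. complements_aw T \<longrightarrow> DNS T" if "?exh"
        by (intro allI impI inf_DNS_imp_DNS iv that)
    qed (intro vi iv'_vi)
    show "?exh \<longrightarrow> (\<forall>T::'a \<Rightarrow>\<^sub>L 'b. complements_aw T \<longrightarrow> inf_DNS T)"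
      by (intro impI allI complements_aw_imp_inf_DNS)
    show "?exh \<longrightarrow> (\<forall>T::'a \<Rightarrow>\<^sub>L 'c. complements_aw T \<longrightarrow> DNS T)"
      by (intro impI allI inf_DNS_imp_DNS complements_aw_imp_inf_DNS)
    show "?exh \<longleftrightarrow> (\<forall>E::'a set. closed_subspace E \<and> aw_agrees_norm_on E \<longrightarrow> inf_dispersed E)"
    proof
      show "\<forall>E::'a set. closed_subspace E \<and> aw_agrees_norm_on E \<longrightarrow> inf_dispersed E" if "?exh"
        using v[OF that] by simp
      show "?exh" if "\<forall>E::'a set. closed_subspace E \<and> aw_agrees_norm_on E \<longrightarrow> inf_dispersed E"
        using that v' by (intro vi v'_vi) simp
    qed
    show "?exh \<longleftrightarrow> (\<forall>E::'a set. closed_subspace E \<and> aw_agrees_norm_on E \<longrightarrow> dispersed E)"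
    proof
      show "\<forall>E::'a set. closed_subspace E \<and> aw_agrees_norm_on E \<longrightarrow> dispersed E" if "?exh"
        using v[OF that] v' by simp
    qed (intro vi v'_vi)
    show "?exh \<longleftrightarrow> \<not> ?agree"
    proof
      assume ?exh
      then have "\<forall>E::'a set. closed_subspace E \<and> aw_agrees_norm_on E \<longrightarrow> dispersed E"
        using v v' by simp
      then show "\<not> ?agree" by (rule v'_vi)
    qed (rule vi)
  qed simp_all
qed

end
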